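(* Let $k\ge7$ and let $\mathfrak{so}(k)=\mathfrak{h}\oplus\mathfrak{m}$ be the reductive decomposition related to $M=\frac{\mathrm{SO}(k)}{\mathrm{SO}(k-4)\times\mathrm{Sp}(1)}$. Then $$\dim_{\mathbb{R}}\mathrm{Hom}_{\mathfrak{h}}(\mathfrak{m}\otimes\mathfrak{m},\mathfrak{m})=63,\qquad\dim_{\mathbb{R}}\mathrm{Hom}_{\mathfrak{h}}(\mathfrak{m},\Lambda^2\mathfrak{m})=30,\qquad\dim_{\mathbb{R}}\mathrm{Hom}_{\mathfrak{h}}(\Lambda^3\mathfrak{m},\mathbb{R})=10.$$
   Context: Put $n=k-4$ and $\mathfrak{so}(k)=\{A\in\mathcal{M}_k(\mathbb{R}):A+A^t=0\}$, matrices in blocks $n+4$. Identify $\mathbb{R}^4$ with the quaternions $\mathbb{H}$; then $\mathfrak{so}(4)=I^-\oplus I^+$ (two commuting copies of $\mathfrak{sp}(1)$), where $I^-$ consists of the matrices of right multiplications $R_q$ and $I^+$ of the matrices of left multiplications $L_q$, with $q$ in the purely imaginary quaternions. The reductive decomposition is $$\mathfrak{h}=\left\{\begin{pmatrix}B&0\\0&C\end{pmatrix}:B\in\mathfrak{so}(n),\ C\in I^-\right\},\qquad\mathfrak{m}=\left\{\begin{pmatrix}0&D\\-D^t&X\end{pmatrix}:D\in\mathcal{M}_{n\times4}(\mathbb{R}),\ X\in I^+\right\}.$$ $\mathfrak{m}$ is an $\mathfrak{h}$-module by the bracket; $\mathfrak{m}\otimes\mathfrak{m}$, $\Lambda^k\mathfrak{m}$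 have the induced actions, $\mathbb{R}$ is the trivial module and $\mathrm{Hom}_{\mathfrak{h}}$ denotes real linear $\mathfrak{h}$-module homomorphisms. *)

theory Defs
  imports "HOL-Analysis.Analysis" "HOL-Library.Function_Algebras" "HOL-Analysis.Finite_Function_Topology"
begin

section \<open>Functions as a real vector space\<close>

text \<open>Pointwise structure; it makes \<open>dim\<close> available for spaces of homomorphisms.\<close>

instantiation "fun" :: (type, real_vector) real_vector
begin

definition scaleR_fun :: "real \<Rightarrow> ('a \<Rightarrow> 'b) \<Rightarrow> 'a \<Rightarrow> 'b"
  where "scaleR_fun r f = (\<lambda>x. r *\<^sub>R f x)"

instance
  by standard (auto simp: scaleR_fun_def fun_eq_iff scaleR_add_right scaleR_add_left)

end

lemma scaleR_fun_apply [simp]: "(r *\<^sub>R f) x = r *\<^sub>R f x"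
  by (simp add: scaleR_fun_def)


section \<open>Free real vector spaces\<close>

text \<open>\<open>'x \<Rightarrow>\<^sub>0 real\<close> is the free real vector space on the set \<open>'x\<close>.\<close>

abbreviation gen :: "'x \<Rightarrow> 'x \<Rightarrow>\<^sub>0 real"
  where "gen x \<equiv> Poly_Mapping.single x 1"

definition free_lift :: "('x \<Rightarrow> 'c::real_vector) \<Rightarrow> ('x \<Rightarrow>\<^sub>0 real) \<Rightarrow> 'c"
  where "free_lift g p = (\<Sum>x\<in>Poly_Mapping.keys p. Poly_Mapping.lookup p x *\<^sub>R g x)"

lemma lookup_scaleR_poly [simp]:
  "Poly_Mapping.lookup (r *\<^sub>R p) x = r *\<^sub>R Poly_Mapping.lookup p x"
proof -
  have "finite {i. r *\<^sub>R Poly_Mapping.lookup p i \<noteq> 0}"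
    by (rule finite_subset[OF _ finite_lookup[of p]]) auto
  then show ?thesis
    by (simp add: scaleR_poly_mapping_def Abs_poly_mapping_inverse)
qed

lemma free_lift_superset:
  assumes "finite S" "Poly_Mapping.keys p \<subseteq> S"
  shows "free_lift g p = (\<Sum>x\<in>S. Poly_Mapping.lookup p x *\<^sub>R g x)"
  unfolding free_lift_def
  by (rule sum.mono_neutral_left) (use assms in \<open>auto simp: in_keys_iff\<close>)

lemma linear_free_lift: "linear (free_lift g)"
proof (rule linearI)
  fix p q :: "'a \<Rightarrow>\<^sub>0 real"
  let ?S = "Poly_Mapping.keys p \<union> Poly_Mapping.keys q"
  have "free_lift g (p + q) = (\<Sum>x\<in>?S. Poly_Mapping.lookup (p + q) x *\<^sub>R g x)"
    using Poly_Mapping.keys_add[of p q] by (intro free_lift_superset) auto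
  also have "\<dots> = free_lift g p + free_lift g q"
    by (simp add: free_lift_superset[where S = ?S] lookup_add scaleR_add_left sum.distrib)
  finally show "free_lift g (p + q) = free_lift g p + free_lift g q" .
next
  fix r :: real and p :: "'a \<Rightarrow>\<^sub>0 real"
  have "Poly_Mapping.keys (r *\<^sub>R p) \<subseteq> Poly_Mapping.keys p"
    by (auto simp: in_keys_iff)
  then have "free_lift g (r *\<^sub>R p)
      = (\<Sum>x\<in>Poly_Mapping.keys p. Poly_Mapping.lookup (r *\<^sub>R p) x *\<^sub>R g x)"
    by (intro free_lift_superset) auto
  then show "free_lift g (r *\<^sub>R p) = r *\<^sub>R free_lift g p"
    by (simp add: free_lift_def scaleR_sum_right)
qed

lemma free_lift_gen [simp]: "free_lift g (gen x) = g x"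
  by (simp add: free_lift_def)

lemma free_lift_vanish_span:
  assumes "\<And>p. p \<in> R \<Longrightarrow> free_lift g p = 0" "p \<in> span R"
  shows "free_lift g p = 0"
  using linear_eq_on[OF linear_free_lift linear_zero, of p R g] assms by auto

lemma free_decomp:
  "p = (\<Sum>x\<in>Poly_Mapping.keys p. Poly_Mapping.lookup p x *\<^sub>R gen x)"
proof (rule poly_mapping_eqI)
  fix k
  have "Poly_Mapping.lookup (\<Sum>x\<in>Poly_Mapping.keys p. Poly_Mapping.lookup p x *\<^sub>R gen x) k
      = (\<Sum>x\<in>Poly_Mapping.keys p. if x = k then Poly_Mapping.lookup p x else 0)"
    unfolding lookup_sum by (rule sum.cong) (auto simp: lookup_single when_def)
  then show "Poly_Mapping.lookup p k
      = Poly_Mapping.lookup (\<Sum>x\<in>Poly_Mapping.keys p. Poly_Mapping.lookup p x *\<^sub>R gen x) k"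
    by (simp add: in_keys_iff)
qed

lemma equivp_diff_span: "equivp (\<lambda>p q. p - q \<in> span R)"
proof (rule equivpI)
  show "reflp (\<lambda>p q. p - q \<in> span R)"
    by (simp add: reflp_def span_zero)
  show "symp (\<lambda>p q. p - q \<in> span R)"
    unfolding symp_def by (metis minus_diff_eq span_neg)
  show "transp (\<lambda>p q. p - q \<in> span R)"
    unfolding transp_def by (metis diff_add_cancel add_diff_eq span_add)
qed

lemma diff_span_add:
  assumes "p - q \<in> span R" "p' - q' \<in> span R"
  shows "(p + p') - (q + q') \<in> span R"
  using span_add[OF assms] by (simp add: algebra_simps)

lemma diff_span_diff:
  assumes "p - q \<in> span R" "p' - q' \<in> span R"
  shows "(p - p') - (q - q') \<in> span R"
  using span_diff[OF assms] by (simp add: algebra_simps)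

lemma diff_span_minus:
  assumes "p - q \<in> span R"
  shows "(- p) - (- q) \<in> span R"
  using span_neg[OF assms] by (simp add: algebra_simps)

lemma diff_span_scale:
  assumes "p - q \<in> span R"
  shows "r *\<^sub>R p - r *\<^sub>R q \<in> span R"
  using span_scale[OF assms, of r] by (simp add: algebra_simps)


section \<open>Tensor product of two real vector spaces\<close>

definition tensor_relations :: "('a::real_vector \<times> 'b::real_vector \<Rightarrow>\<^sub>0 real) set"
  where "tensor_relations =
      {gen (a + b, y) - gen (a, y) - gen (b, y) | a b y. True}
    \<union> {gen (x, a + b) - gen (x, a) - gen (x, b) | x a b. True}
    \<union> {gen (c *\<^sub>R x, y) - c *\<^sub>R gen (x, y) | c x y. True}
    \<union> {gen (x, c *\<^sub>R y) - c *\<^sub>R gen (x, y) | c x y. True}"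

quotient_type (overloaded) ('a, 'b) tensor =
  "('a::real_vector \<times> 'b::real_vector) \<Rightarrow>\<^sub>0 real" /
  "\<lambda>p q. p - q \<in> span tensor_relations"
  by (rule equivp_diff_span)

instantiation tensor :: (real_vector, real_vector) real_vector
begin

lift_definition zero_tensor :: "('a, 'b) tensor" is 0 .
lift_definition plus_tensor :: "('a, 'b) tensor \<Rightarrow> ('a, 'b) tensor \<Rightarrow> ('a, 'b) tensor"
  is "(+)" by (rule diff_span_add)
lift_definition minus_tensor :: "('a, 'b) tensor \<Rightarrow> ('a, 'b) tensor \<Rightarrow> ('a, 'b) tensor"
  is "(-)" by (rule diff_span_diff)
lift_definition uminus_tensor :: "('a, 'b) tensor \<Rightarrow> ('a, 'b) tensor"
  is uminus by (rule diff_span_minus)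
lift_definition scaleR_tensor :: "real \<Rightarrow> ('a, 'b) tensor \<Rightarrow> ('a, 'b) tensor"
  is scaleR by (rule diff_span_scale)

instance
  by standard (transfer; simp add: algebra_simps span_zero)+

end

lift_definition tens :: "'a::real_vector \<Rightarrow> 'b::real_vector \<Rightarrow> ('a, 'b) tensor"
  is "\<lambda>x y. gen (x, y)" .

text \<open>The linear map on the tensor product induced by a bilinear map.\<close>

definition tensor_lift ::
    "('a::real_vector \<Rightarrow> 'b::real_vector \<Rightarrow> 'c::real_vector) \<Rightarrow> ('a, 'b) tensor \<Rightarrow> 'c"
  where "tensor_lift B = (THE F. linear F \<and> (\<forall>x y. F (tens x y) = B x y))"

lemma bilinear_tens: "bilinear tens"
proof -
  have rel: "p \<in> tensor_relations \<Longrightarrow> p \<in> span tensor_relations"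
    for p :: "'a \<times> 'b \<Rightarrow>\<^sub>0 real" by (rule span_base)
  show ?thesis
    unfolding bilinear_def
  proof (intro conjI allI linearI)
    fix x :: 'a and a b :: 'b
    show "tens x (a + b) = tens x a + tens x b"
      by transfer (unfold diff_diff_eq[symmetric], rule rel, unfold tensor_relations_def, blast)
  next
    fix x :: 'a and c and y :: 'b
    show "tens x (c *\<^sub>R y) = c *\<^sub>R tens x y"
      by transfer (rule rel, unfold tensor_relations_def, blast)
  next
    fix y :: 'b and a b :: 'a
    show "tens (a + b) y = tens a y + tens b y"
      by transfer (unfold diff_diff_eq[symmetric], rule rel, unfold tensor_relations_def, blast)
  next
    fix y :: 'b and c and x :: 'a
    show "tens (c *\<^sub>R x) y = c *\<^sub>R tens x y"
      by transfer (rule rel, unfold tensor_relations_def, blast)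
  qed
qed

lemma span_tens: "span (range (\<lambda>(x, y). tens x y)) = (UNIV :: ('a::real_vector, 'b::real_vector) tensor set)"
proof (rule set_eqI, simp)
  fix t :: "('a, 'b) tensor"
  let ?abs = "abs_tensor :: ('a \<times> 'b \<Rightarrow>\<^sub>0 real) \<Rightarrow> _"
  obtain p where p: "t = ?abs p"
    using Quotient3_abs_rep[OF Quotient3_tensor, of t, symmetric] by blast
  have lin: "linear ?abs"
    by (rule linearI) (simp_all add: plus_tensor.abs_eq scaleR_tensor.abs_eq)
  have "t = (\<Sum>x\<in>Poly_Mapping.keys p. Poly_Mapping.lookup p x *\<^sub>R ?abs (gen x))"
    by (subst p, subst free_decomp[of p])
      (simp add: linear_sum[OF lin] linear_scale[OF lin])
  also have "\<dots> \<in> span (range (\<lambda>(x, y). tens x y))"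
    by (intro span_sum span_scale span_base) (auto simp: tens.abs_eq image_iff intro!: exI)
  finally show "t \<in> span (range (\<lambda>(x, y). tens x y))" .
qed

lemma tensor_universal:
  fixes B :: "'a::real_vector \<Rightarrow> 'b::real_vector \<Rightarrow> 'c::real_vector"
  assumes "bilinear B"
  shows "\<exists>!F. linear F \<and> (\<forall>x y. F (tens x y) = B x y)"
proof (rule ex_ex1I)
  let ?g = "free_lift (\<lambda>(x, y). B x y)"
  have 0: "?g p = 0" if "p \<in> span tensor_relations" for p
  proof (rule free_lift_vanish_span[OF _ that])
    fix p :: "'a \<times> 'b \<Rightarrow>\<^sub>0 real" assume "p \<in> tensor_relations"
    then show "?g p = 0"
      unfolding tensor_relations_def
      by (auto simp: linear_diff[OF linear_free_lift] linear_scale[OF linear_free_lift]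
          bilinear_ladd[OF assms] bilinear_radd[OF assms]
          bilinear_lmul[OF assms] bilinear_rmul[OF assms])
  qed
  define F where "F t = ?g (rep_tensor t)" for t
  have F: "F (abs_tensor p) = ?g p" for p
  proof -
    have "rep_tensor (abs_tensor p) - p \<in> span tensor_relations"
      by (rule Quotient3_rep_abs[OF Quotient3_tensor]) (simp add: span_zero)
    from 0[OF this] show ?thesis
      by (simp add: F_def linear_diff[OF linear_free_lift])
  qed
  have ex: "\<exists>p. t = abs_tensor p" for t :: "('a, 'b) tensor"
    using Quotient3_abs_rep[OF Quotient3_tensor, of t, symmetric] by blast
  have "linear F"
  proof (rule linearI)
    fix s t :: "('a, 'b) tensor"
    obtain p q where "s = abs_tensor p" "t = abs_tensor q" using ex by metis
    then show "F (s + t) = F s + F t"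
      by (simp add: plus_tensor.abs_eq F linear_add[OF linear_free_lift])
  next
    fix r and t :: "('a, 'b) tensor"
    obtain p where "t = abs_tensor p" using ex by metis
    then show "F (r *\<^sub>R t) = r *\<^sub>R F t"
      by (simp add: scaleR_tensor.abs_eq F linear_scale[OF linear_free_lift])
  qed
  moreover have "F (tens x y) = B x y" for x y
    by (simp add: tens.abs_eq F)
  ultimately show "\<exists>F. linear F \<and> (\<forall>x y. F (tens x y) = B x y)" by blast
next
  fix F G :: "('a, 'b) tensor \<Rightarrow> 'c"
  assume F: "linear F \<and> (\<forall>x y. F (tens x y) = B x y)"
    and G: "linear G \<and> (\<forall>x y. G (tens x y) = B x y)"
  show "F = G"
  proof
    fix t
    show "F t = G t"
      by (rule linear_eq_on[of F G t "range (\<lambda>(x, y). tens x y)"]) (use F G in \<open>auto simp: span_tens\<close>)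
  qed
qed

lemma
  assumes "bilinear B"
  shows linear_tensor_lift: "linear (tensor_lift B)"
    and tensor_lift_tens: "tensor_lift B (tens x y) = B x y"
  using theI'[OF tensor_universal[OF assms]] unfolding tensor_lift_def by auto


section \<open>Exterior powers\<close>

text \<open>
  \<open>('a, 'k) ext\<close> is the exterior power of \<open>'a\<close> of order \<open>CARD('k)\<close>: the free vector space on
  families \<open>'k \<Rightarrow> 'a\<close> modulo multilinearity and the vanishing of families with a repeated entry.
  With \<open>'k\<close> the numeral type \<open>2\<close> or \<open>3\<close> this is the second or third exterior power.
\<close>

definition ext_relations :: "(('k::finite \<Rightarrow> 'a::real_vector) \<Rightarrow>\<^sub>0 real) set"
  where "ext_relations =
      {gen (v(i := x + y)) - gen (v(i := x)) - gen (v(i := y)) | v i x y. True}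
    \<union> {gen (v(i := c *\<^sub>R x)) - c *\<^sub>R gen (v(i := x)) | v i c x. True}
    \<union> {gen v | v. \<exists>i j. i \<noteq> j \<and> v i = v j}"

quotient_type (overloaded) ('a, 'k) ext =
  "('k::finite \<Rightarrow> 'a::real_vector) \<Rightarrow>\<^sub>0 real" /
  "\<lambda>p q. p - q \<in> span ext_relations"
  by (rule equivp_diff_span)

instantiation ext :: (real_vector, finite) real_vector
begin

lift_definition zero_ext :: "('a, 'b) ext" is 0 .
lift_definition plus_ext :: "('a, 'b) ext \<Rightarrow> ('a, 'b) ext \<Rightarrow> ('a, 'b) ext"
  is "(+)" by (rule diff_span_add)
lift_definition minus_ext :: "('a, 'b) ext \<Rightarrow> ('a, 'b) ext \<Rightarrow> ('a, 'b) ext"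
  is "(-)" by (rule diff_span_diff)
lift_definition uminus_ext :: "('a, 'b) ext \<Rightarrow> ('a, 'b) ext"
  is uminus by (rule diff_span_minus)
lift_definition scaleR_ext :: "real \<Rightarrow> ('a, 'b) ext \<Rightarrow> ('a, 'b) ext"
  is scaleR by (rule diff_span_scale)

instance
  by standard (transfer; simp add: algebra_simps span_zero)+

end

lift_definition wedge :: "('k::finite \<Rightarrow> 'a::real_vector) \<Rightarrow> ('a, 'k) ext"
  is "\<lambda>v. gen v" .

definition multilinear :: "(('k \<Rightarrow> 'a::real_vector) \<Rightarrow> 'c::real_vector) \<Rightarrow> bool"
  where "multilinear g \<longleftrightarrow> (\<forall>v i. linear (\<lambda>x. g (v(i := x))))"

definition alternating :: "(('k \<Rightarrow> 'a::real_vector) \<Rightarrow> 'c::real_vector) \<Rightarrow> bool"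
  where "alternating g \<longleftrightarrow> (\<forall>v i j. i \<noteq> j \<longrightarrow> v i = v j \<longrightarrow> g v = 0)"

text \<open>The linear map on the exterior power induced by an alternating multilinear map.\<close>

definition ext_lift ::
    "(('k::finite \<Rightarrow> 'a::real_vector) \<Rightarrow> 'c::real_vector) \<Rightarrow> ('a, 'k) ext \<Rightarrow> 'c"
  where "ext_lift g = (THE F. linear F \<and> (\<forall>v. F (wedge v) = g v))"

lemma multilinear_wedge: "multilinear wedge"
proof -
  have rel: "p \<in> ext_relations \<Longrightarrow> p \<in> span ext_relations"
    for p :: "('a \<Rightarrow> 'b) \<Rightarrow>\<^sub>0 real" by (rule span_base)
  show ?thesis
    unfolding multilinear_def
  proof (intro allI linearI)
    fix v :: "'a \<Rightarrow> 'b" and i x y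
    show "wedge (v(i := x + y)) = wedge (v(i := x)) + wedge (v(i := y))"
      by transfer (unfold diff_diff_eq[symmetric], rule rel, unfold ext_relations_def, blast)
  next
    fix v :: "'a \<Rightarrow> 'b" and i c x
    show "wedge (v(i := c *\<^sub>R x)) = c *\<^sub>R wedge (v(i := x))"
      by transfer (rule rel, unfold ext_relations_def, blast)
  qed
qed

lemma alternating_wedge: "alternating wedge"
  unfolding alternating_def
proof (intro allI impI)
  fix v :: "'a \<Rightarrow> 'b" and i j
  assume "i \<noteq> j" "v i = v j"
  then have "gen v \<in> (ext_relations :: (('a \<Rightarrow> 'b) \<Rightarrow>\<^sub>0 real) set)"
    unfolding ext_relations_def by blast
  then have "gen v - 0 \<in> span (ext_relations :: (('a \<Rightarrow> 'b) \<Rightarrow>\<^sub>0 real) set)"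
    by (simp add: span_base)
  then show "wedge v = 0"
    by transfer
qed

lemma span_wedge: "span (range wedge) = (UNIV :: ('a::real_vector, 'k::finite) ext set)"
proof (rule set_eqI, simp)
  fix t :: "('a, 'k) ext"
  let ?abs = "abs_ext :: (('k \<Rightarrow> 'a) \<Rightarrow>\<^sub>0 real) \<Rightarrow> _"
  obtain p where p: "t = ?abs p"
    using Quotient3_abs_rep[OF Quotient3_ext, of t, symmetric] by blast
  have lin: "linear ?abs"
    by (rule linearI) (simp_all add: plus_ext.abs_eq scaleR_ext.abs_eq)
  have "t = (\<Sum>x\<in>Poly_Mapping.keys p. Poly_Mapping.lookup p x *\<^sub>R ?abs (gen x))"
    by (subst p, subst free_decomp[of p])
      (simp add: linear_sum[OF lin] linear_scale[OF lin])
  also have "\<dots> \<in> span (range wedge)"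
    by (intro span_sum span_scale span_base) (auto simp: wedge.abs_eq)
  finally show "t \<in> span (range wedge)" .
qed

lemma ext_universal:
  fixes g :: "('k::finite \<Rightarrow> 'a::real_vector) \<Rightarrow> 'c::real_vector"
  assumes "multilinear g" "alternating g"
  shows "\<exists>!F. linear F \<and> (\<forall>v. F (wedge v) = g v)"
proof (rule ex_ex1I)
  let ?g = "free_lift g"
  have lin: "linear (\<lambda>x. g (v(i := x)))" for v i
    using assms(1) by (simp add: multilinear_def)
  have 0: "?g p = 0" if "p \<in> span ext_relations" for p
  proof (rule free_lift_vanish_span[OF _ that])
    fix p :: "('k \<Rightarrow> 'a) \<Rightarrow>\<^sub>0 real" assume "p \<in> ext_relations"
    then show "?g p = 0"
      using assms(2) unfolding ext_relations_def
      by (auto simp: linear_diff[OF linear_free_lift] linear_scale[OF linear_free_lift]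
          linear_add[OF lin] linear_scale[OF lin] alternating_def)
  qed
  define F where "F t = ?g (rep_ext t)" for t
  have F: "F (abs_ext p) = ?g p" for p
  proof -
    have "rep_ext (abs_ext p) - p \<in> span ext_relations"
      by (rule Quotient3_rep_abs[OF Quotient3_ext]) (simp add: span_zero)
    from 0[OF this] show ?thesis
      by (simp add: F_def linear_diff[OF linear_free_lift])
  qed
  have ex: "\<exists>p. t = abs_ext p" for t :: "('a, 'k) ext"
    using Quotient3_abs_rep[OF Quotient3_ext, of t, symmetric] by blast
  have "linear F"
  proof (rule linearI)
    fix s t :: "('a, 'k) ext"
    obtain p q where "s = abs_ext p" "t = abs_ext q" using ex by metis
    then show "F (s + t) = F s + F t"
      by (simp add: plus_ext.abs_eq F linear_add[OF linear_free_lift])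
  next
    fix r and t :: "('a, 'k) ext"
    obtain p where "t = abs_ext p" using ex by metis
    then show "F (r *\<^sub>R t) = r *\<^sub>R F t"
      by (simp add: scaleR_ext.abs_eq F linear_scale[OF linear_free_lift])
  qed
  moreover have "F (wedge v) = g v" for v
    by (simp add: wedge.abs_eq F)
  ultimately show "\<exists>F. linear F \<and> (\<forall>v. F (wedge v) = g v)" by blast
next
  fix F G :: "('a, 'k) ext \<Rightarrow> 'c"
  assume F: "linear F \<and> (\<forall>v. F (wedge v) = g v)"
    and G: "linear G \<and> (\<forall>v. G (wedge v) = g v)"
  show "F = G"
  proof
    fix t
    show "F t = G t"
      by (rule linear_eq_on[of F G t "range wedge"]) (use F G in \<open>auto simp: span_wedge\<close>)
  qed
qed

lemma
  assumes "multilinear g" "alternating g"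
  shows linear_ext_lift: "linear (ext_lift g)"
    and ext_lift_wedge: "ext_lift g (wedge v) = g v"
  using theI'[OF ext_universal[OF assms]] unfolding ext_lift_def by auto


section \<open>Modules over a set of operators\<close>

text \<open>
  An action of \<open>\<hh>\<close> on \<open>'v\<close> is given by \<open>\<rho> :: 'g \<Rightarrow> 'v \<Rightarrow> 'v\<close>, where \<open>\<rho> X\<close> is the operator by which
  \<open>X \<in> \<hh>\<close> acts.
\<close>

definition Hom_mod ::
    "'g set \<Rightarrow> ('g \<Rightarrow> 'v \<Rightarrow> 'v) \<Rightarrow> ('g \<Rightarrow> 'w \<Rightarrow> 'w) \<Rightarrow> ('v::real_vector \<Rightarrow> 'w::real_vector) set"
  where "Hom_mod H \<rho> \<sigma> = {f. linear f \<and> (\<forall>X\<in>H. \<forall>v. f (\<rho> X v) = \<sigma> X (f v))}"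

definition trivial_action :: "'g \<Rightarrow> real \<Rightarrow> real"
  where "trivial_action X c = 0"

definition tensor_action ::
    "('g \<Rightarrow> 'v \<Rightarrow> 'v) \<Rightarrow> ('g \<Rightarrow> 'w \<Rightarrow> 'w) \<Rightarrow> 'g \<Rightarrow>
      ('v::real_vector, 'w::real_vector) tensor \<Rightarrow> ('v, 'w) tensor"
  where "tensor_action \<rho> \<sigma> X = tensor_lift (\<lambda>x y. tens (\<rho> X x) y + tens x (\<sigma> X y))"

definition ext_action ::
    "('g \<Rightarrow> 'v \<Rightarrow> 'v) \<Rightarrow> 'g \<Rightarrow> ('v::real_vector, 'k::finite) ext \<Rightarrow> ('v, 'k) ext"
  where "ext_action \<rho> X = ext_lift (\<lambda>v. \<Sum>i\<in>UNIV. wedge (v(i := \<rho> X (v i))))"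

lemma subspace_Hom_mod:
  assumes "\<And>X. X \<in> H \<Longrightarrow> linear (\<sigma> X)"
  shows "subspace (Hom_mod H \<rho> \<sigma>)"
  unfolding subspace_def Hom_mod_def
  by (auto simp: linear_iff algebra_simps linear_0[OF assms] linear_add[OF assms] linear_scale[OF assms])

lemma tensor_action_bilinear:
  assumes "linear (\<rho> X)" "linear (\<sigma> X)"
  shows "bilinear (\<lambda>x y. tens (\<rho> X x) y + tens x (\<sigma> X y))"
  unfolding bilinear_def
  by (auto simp: linear_iff algebra_simps linear_add[OF assms(1)] linear_add[OF assms(2)]
      linear_scale[OF assms(1)] linear_scale[OF assms(2)]
      bilinear_ladd[OF bilinear_tens] bilinear_radd[OF bilinear_tens]
      bilinear_lmul[OF bilinear_tens] bilinear_rmul[OF bilinear_tens])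

lemma
  assumes "linear (\<rho> X)" "linear (\<sigma> X)"
  shows linear_tensor_action: "linear (tensor_action \<rho> \<sigma> X)"
    and tensor_action_tens:
      "tensor_action \<rho> \<sigma> X (tens x y) = tens (\<rho> X x) y + tens x (\<sigma> X y)"
  using linear_tensor_lift[OF tensor_action_bilinear[of \<rho> X \<sigma>, OF assms]]
    tensor_lift_tens[OF tensor_action_bilinear[of \<rho> X \<sigma>, OF assms]]
  unfolding tensor_action_def by auto

lemma linear_wedge: "linear (\<lambda>x. wedge (v(i := x)))"
  by (rule multilinear_wedge[unfolded multilinear_def, rule_format])

lemma wedge_repeat:
  assumes "i \<noteq> j" "v i = v j"
  shows "wedge v = 0"
  using alternating_wedge assms by (auto simp: alternating_def)

lemma wedge_swap:
  assumes "i \<noteq> j"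
  shows "wedge (v(i := x, j := y)) + wedge (v(i := y, j := x)) = 0"
proof -
  have tw: "v(i := a, j := b) = v(j := b, i := a)" for a b
    using assms by (rule fun_upd_twist)
  have z: "wedge (v(i := a, j := a)) = 0" for a
    by (rule wedge_repeat[OF assms]) (use assms in auto)
  have "0 = wedge (v(i := x + y, j := x + y))"
    by (simp add: z)
  also have "\<dots> = wedge (v(i := x + y, j := x)) + wedge (v(i := x + y, j := y))"
    by (rule linear_add[OF linear_wedge])
  also have "wedge (v(i := x + y, j := x)) = wedge (v(i := x, j := x)) + wedge (v(i := y, j := x))"
    unfolding tw by (rule linear_add[OF linear_wedge])
  also have "wedge (v(i := x + y, j := y)) = wedge (v(i := x, j := y)) + wedge (v(i := y, j := y))"
    unfolding tw by (rule linear_add[OF linear_wedge])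
  finally show ?thesis
    unfolding z by (metis add.commute add_0_left add_0_right)
qed

lemma ext_action_multilinear:
  assumes "linear \<phi>"
  shows "multilinear (\<lambda>v. \<Sum>i\<in>UNIV. wedge (v(i := \<phi> (v i))))"
  unfolding multilinear_def
proof (intro allI linear_compose_sum ballI)
  fix v :: "'b \<Rightarrow> 'a" and i j
  show "linear (\<lambda>x. wedge ((v(i := x))(j := \<phi> ((v(i := x)) j))))"
  proof (cases "i = j")
    case True
    then show ?thesis
      using linear_compose[OF assms linear_wedge[of v j]] by (simp add: o_def)
  next
    case False
    then show ?thesis
      using linear_wedge[of "v(j := \<phi> (v j))" i] by (simp add: fun_upd_twist[OF False])
  qed
qed

lemma ext_action_alternating:
  fixes \<phi> :: "'a::real_vector \<Rightarrow> 'a"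
  shows "alternating (\<lambda>v :: 'k::finite \<Rightarrow> 'a. \<Sum>i\<in>UNIV. wedge (v(i := \<phi> (v i))))"
  unfolding alternating_def
proof (intro allI impI)
  fix v :: "'k \<Rightarrow> 'a" and i j
  assume ij: "i \<noteq> j" and v: "v i = v j"
  have "(\<Sum>l\<in>UNIV. wedge (v(l := \<phi> (v l)))) = (\<Sum>l\<in>{i, j}. wedge (v(l := \<phi> (v l))))"
  proof (rule sum.mono_neutral_right)
    show "\<forall>l\<in>UNIV - {i, j}. wedge (v(l := \<phi> (v l))) = 0"
    proof
      fix l assume "l \<in> UNIV - {i, j}"
      then show "wedge (v(l := \<phi> (v l))) = 0"
        using ij v by (intro wedge_repeat[of i j]) auto
    qed
  qed auto
  also have "\<dots> = wedge (v(i := \<phi> (v i), j := v i)) + wedge (v(i := v i, j := \<phi> (v i)))"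
    using ij v by (simp add: fun_upd_idem)
  also have "\<dots> = 0"
    by (rule wedge_swap[OF ij])
  finally show "(\<Sum>l\<in>UNIV. wedge (v(l := \<phi> (v l)))) = 0" .
qed

lemma
  assumes "linear (\<rho> X)"
  shows linear_ext_action: "linear (ext_action \<rho> X)"
    and ext_action_wedge:
      "ext_action \<rho> X (wedge v) = (\<Sum>i\<in>UNIV. wedge (v(i := \<rho> X (v i))))"
  using linear_ext_lift[OF ext_action_multilinear[OF assms] ext_action_alternating]
    ext_lift_wedge[OF ext_action_multilinear[OF assms] ext_action_alternating]
  unfolding ext_action_def by auto


section \<open>The reductive decomposition\<close>

definition so :: "(real^'k^'k) set"
  where "so = {A. A + transpose A = 0}"

definition bracket :: "real^'k^'k \<Rightarrow> real^'k^'k \<Rightarrow> real^'k^'k"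
  where "bracket A B = A ** B - B ** A"

text \<open>Quaternions as \<open>real^4\<close>, with respect to the basis \<open>1, i, j, k\<close>.\<close>

definition qmult :: "real^4 \<Rightarrow> real^4 \<Rightarrow> real^4"
  where "qmult p q = vector
    [p$1 * q$1 - p$2 * q$2 - p$3 * q$3 - p$4 * q$4,
     p$1 * q$2 + p$2 * q$1 + p$3 * q$4 - p$4 * q$3,
     p$1 * q$3 - p$2 * q$4 + p$3 * q$1 + p$4 * q$2,
     p$1 * q$4 + p$2 * q$3 - p$3 * q$2 + p$4 * q$1]"

definition imaginary :: "(real^4) set"
  where "imaginary = {q. q$1 = 0}"

definition Lmat :: "real^4 \<Rightarrow> real^4^4"
  where "Lmat q = matrix (\<lambda>x. qmult q x)"

definition Rmat :: "real^4 \<Rightarrow> real^4^4"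
  where "Rmat q = matrix (\<lambda>x. qmult x q)"

definition I_minus :: "(real^4^4) set"
  where "I_minus = Rmat ` imaginary"

definition I_plus :: "(real^4^4) set"
  where "I_plus = Lmat ` imaginary"

text \<open>
  Matrices of size \<open>k = n + 4\<close> have rows and columns indexed by the sum type \<open>'n + 4\<close>;
  note that an \<open>n \<times> 4\<close> matrix has type \<open>real^4^'n\<close>.
\<close>

definition block ::
    "real^'n^'n \<Rightarrow> real^4^'n \<Rightarrow> real^'n^4 \<Rightarrow> real^4^4 \<Rightarrow> real^('n::finite + 4)^('n + 4)"
  where "block A B C D = (\<chi> i j.
    case i of
      Inl a \<Rightarrow> (case j of Inl b \<Rightarrow> A $ a $ b | Inr b \<Rightarrow> B $ a $ b)
    | Inr a \<Rightarrow> (case j of Inl b \<Rightarrow> C $ a $ b | Inr b \<Rightarrow> D $ a $ b))"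

definition h_alg :: "(real^('n::finite + 4)^('n + 4)) set"
  where "h_alg = {block B 0 0 C | B C. B \<in> so \<and> C \<in> I_minus}"

definition m_set :: "(real^('n::finite + 4)^('n + 4)) set"
  where "m_set = {block 0 D (- transpose D) X | D X. X \<in> I_plus}"

lemma vector_4 [simp]:
  "(vector [a, b, c, d] :: real^4) $ 1 = a" "(vector [a, b, c, d] :: real^4) $ 2 = b"
  "(vector [a, b, c, d] :: real^4) $ 3 = c" "(vector [a, b, c, d] :: real^4) $ 4 = d"
  unfolding vector_def by simp_all

lemma Lmat_nth: "Lmat q $ i $ j = qmult q (axis j 1) $ i"
  by (simp add: Lmat_def matrix_def)

lemma Rmat_nth: "Rmat q $ i $ j = qmult (axis j 1) q $ i"
  by (simp add: Rmat_def matrix_def)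

lemma Lmat_works: "Lmat q *v x = qmult q x"
  by (simp add: vec_eq_iff forall_4 matrix_vector_mult_def sum_4 Lmat_nth qmult_def axis_def)

lemma Rmat_works: "Rmat q *v x = qmult x q"
  by (simp add: vec_eq_iff forall_4 matrix_vector_mult_def sum_4 Rmat_nth qmult_def axis_def)

lemma qmult_assoc: "qmult (qmult p q) r = qmult p (qmult q r)"
  by (simp add: vec_eq_iff forall_4 qmult_def algebra_simps)

lemma Lmat_Rmat_commute: "Lmat p ** Rmat q = Rmat q ** Lmat p"
  by (simp add: matrix_eq matrix_vector_mul_assoc[symmetric] Lmat_works Rmat_works qmult_assoc)

lemma I_plus_add: "A \<in> I_plus \<Longrightarrow> B \<in> I_plus \<Longrightarrow> A + B \<in> I_plus"
proof -
  assume "A \<in> I_plus" "B \<in> I_plus"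
  then obtain p q where pq: "A = Lmat p" "B = Lmat q" "p \<in> imaginary" "q \<in> imaginary"
    by (auto simp: I_plus_def)
  have "A + B = Lmat (p + q)"
    unfolding pq by (simp add: vec_eq_iff Lmat_nth forall_4 qmult_def algebra_simps)
  with pq show ?thesis
    by (auto simp: I_plus_def imaginary_def)
qed

lemma I_plus_scale: "A \<in> I_plus \<Longrightarrow> c *\<^sub>R A \<in> I_plus"
proof -
  assume "A \<in> I_plus"
  then obtain p where p: "A = Lmat p" "p \<in> imaginary"
    by (auto simp: I_plus_def)
  have "c *\<^sub>R A = Lmat (c *\<^sub>R p)"
    unfolding p by (simp add: vec_eq_iff Lmat_nth forall_4 qmult_def algebra_simps)
  with p show ?thesis
    by (auto simp: I_plus_def imaginary_def)
qed

lemma I_plus_0: "0 \<in> I_plus"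
proof -
  have "Lmat 0 = 0"
    by (simp add: vec_eq_iff Lmat_nth forall_4 qmult_def)
  then show ?thesis
    by (metis (mono_tags) I_plus_def imageI imaginary_def mem_Collect_eq zero_index)
qed

lemma I_minus_so: "C \<in> I_minus \<Longrightarrow> C \<in> so"
  by (auto simp: I_minus_def so_def imaginary_def vec_eq_iff forall_4 transpose_def Rmat_nth qmult_def axis_def)

lemma I_plus_so: "X \<in> I_plus \<Longrightarrow> X \<in> so"
  by (auto simp: I_plus_def so_def imaginary_def vec_eq_iff forall_4 transpose_def Lmat_nth qmult_def axis_def)

lemma so4_decomposition:
  assumes "A \<in> so"
  shows "\<exists>C X. C \<in> I_minus \<and> X \<in> I_plus \<and> A = C + X"
proof -
  have sk: "A $ i $ j = - A $ j $ i" for i j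
  proof -
    have "(A + transpose A) $ i $ j = 0"
      using assms by (simp add: so_def)
    then show ?thesis
      by (simp add: transpose_def)
  qed
  have d: "A $ i $ i = 0" for i
    using sk[of i i] by simp
  define q :: "real^4" where
    "q = vector [0, (A$2$1 + A$4$3) / 2, (A$3$1 + A$2$4) / 2, (A$4$1 + A$3$2) / 2]"
  define p :: "real^4" where
    "p = vector [0, (A$2$1 - A$4$3) / 2, (A$3$1 - A$2$4) / 2, (A$4$1 - A$3$2) / 2]"
  have "A = Rmat p + Lmat q"
    using sk[of 1 2] sk[of 1 3] sk[of 1 4] sk[of 2 3] sk[of 3 4] sk[of 4 2]
    by (simp add: vec_eq_iff forall_4 Lmat_nth Rmat_nth qmult_def axis_def p_def q_def d field_simps)
  moreover have "p \<in> imaginary" "q \<in> imaginary"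
    by (simp_all add: imaginary_def p_def q_def)
  ultimately show ?thesis
    unfolding I_minus_def I_plus_def by blast
qed

lemma I_minus_Int_I_plus: "I_minus \<inter> I_plus = {0}"
proof -
  have "Rmat p = 0" if "Rmat p = Lmat q" "p \<in> imaginary" "q \<in> imaginary" for p q
    using that
    by (auto simp: imaginary_def vec_eq_iff forall_4 Lmat_nth Rmat_nth qmult_def axis_def)
  moreover have "Rmat 0 = 0"
    by (simp add: vec_eq_iff Rmat_nth forall_4 qmult_def)
  then have "0 \<in> I_minus"
    by (metis (mono_tags) I_minus_def imageI imaginary_def mem_Collect_eq zero_index)
  ultimately show ?thesis
    using I_plus_0 by (auto simp: I_minus_def I_plus_def)
qed

lemma all_sum: "(\<forall>i :: 'a + 'b. P i) \<longleftrightarrow> (\<forall>a. P (Inl a)) \<and> (\<forall>b. P (Inr b))"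
  by (metis sum.exhaust)

lemma block_eq_iff: "block A B C D = block A' B' C' D' \<longleftrightarrow> A = A' \<and> B = B' \<and> C = C' \<and> D = D'"
  by (auto simp: block_def vec_eq_iff all_sum)

lemma block_surj: "\<exists>A B C D. M = block A B C D"
  by (rule exI[of _ "\<chi> a b. M $ Inl a $ Inl b"], rule exI[of _ "\<chi> a b. M $ Inl a $ Inr b"],
      rule exI[of _ "\<chi> a b. M $ Inr a $ Inl b"], rule exI[of _ "\<chi> a b. M $ Inr a $ Inr b"])
    (auto simp: block_def vec_eq_iff all_sum)

lemma block_add: "block A B C D + block A' B' C' D' = block (A + A') (B + B') (C + C') (D + D')"
  by (auto simp: block_def vec_eq_iff all_sum)

lemma block_diff: "block A B C D - block A' B' C' D' = block (A - A') (B - B') (C - C') (D - D')"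
  by (auto simp: block_def vec_eq_iff all_sum)

lemma block_scale: "c *\<^sub>R block A B C D = block (c *\<^sub>R A) (c *\<^sub>R B) (c *\<^sub>R C) (c *\<^sub>R D)"
  by (auto simp: block_def vec_eq_iff all_sum)

lemma block_0: "block 0 0 0 0 = 0"
  by (auto simp: block_def vec_eq_iff all_sum)

lemma block_transpose: "transpose (block A B C D) = block (transpose A) (transpose C) (transpose B) (transpose D)"
  by (auto simp: block_def vec_eq_iff all_sum transpose_def)

lemma sum_UNIV_sum: "sum f (UNIV :: ('a::finite + 'b::finite) set) = (\<Sum>a\<in>UNIV. f (Inl a)) + (\<Sum>b\<in>UNIV. f (Inr b))"
  using sum.Plus[of "UNIV :: 'a set" "UNIV :: 'b set" f] by (simp add: UNIV_Plus_UNIV o_def)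

lemma block_mult:
  "block A B C D ** block A' B' C' D'
    = block (A ** A' + B ** C') (A ** B' + B ** D') (C ** A' + D ** C') (C ** B' + D ** D')"
  by (auto simp: block_def vec_eq_iff all_sum matrix_matrix_mult_def sum_UNIV_sum)

lemma transpose_diff_mat: "transpose (A - B) = transpose A - transpose (B :: real^'a^'b)"
  by (simp add: transpose_def vec_eq_iff)

lemma transpose_add_mat: "transpose (A + B) = transpose A + transpose (B :: real^'a^'b)"
  by (simp add: transpose_def vec_eq_iff)

lemma transpose_scale_mat: "transpose (c *\<^sub>R A) = c *\<^sub>R transpose (A :: real^'a^'b)"
  by (simp add: transpose_def vec_eq_iff)

lemma transpose_0_mat: "transpose (0 :: real^'a^'b) = 0"
  by (simp add: transpose_def vec_eq_iff)

lemma minus_matrix_mult_left: "(- A) ** B = - (A ** (B :: real^'c^'a))" for A :: "real^'a^'b"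
  by (simp add: matrix_matrix_mult_def vec_eq_iff sum_negf)

lemma minus_matrix_mult_right: "A ** (- B) = - (A ** (B :: real^'c^'a))" for A :: "real^'a^'b"
  by (simp add: matrix_matrix_mult_def vec_eq_iff sum_negf)

lemma matrix_add_rdistrib': "(A + B) ** C = A ** C + B ** (C :: real^'c^'a)" for A B :: "real^'a^'b"
  by (simp add: matrix_matrix_mult_def vec_eq_iff sum.distrib algebra_simps)

lemma matrix_scaleR_left': "(c *\<^sub>R A) ** B = c *\<^sub>R (A ** (B :: real^'c^'a))" for A :: "real^'a^'b"
  by (simp add: matrix_matrix_mult_def vec_eq_iff sum_distrib_left algebra_simps)

lemma matrix_scaleR_right': "A ** (c *\<^sub>R B) = c *\<^sub>R (A ** (B :: real^'c^'a))" for A :: "real^'a^'b"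
  by (simp add: matrix_matrix_mult_def vec_eq_iff sum_distrib_left algebra_simps)

lemma so_transpose: "A \<in> so \<longleftrightarrow> transpose A = - A"
  by (auto simp: so_def add_eq_0_iff)

theorem so_eq_h_plus_m: "(so :: (real^('n::finite + 4)^('n + 4)) set) = {Y + Z | Y Z. Y \<in> h_alg \<and> Z \<in> m_set}"
proof (intro set_eqI iffI)
  fix M :: "real^('n + 4)^('n + 4)"
  assume M: "M \<in> so"
  obtain A B C D where b: "M = block A B C D"
    using block_surj by blast
  have "A + transpose A = 0" "D + transpose D = 0" "C + transpose B = 0"
    using M by (simp_all add: so_def b block_transpose block_add block_0[symmetric] block_eq_iff)
  then have "A \<in> so" "D \<in> so" "C = - transpose B"
    by (simp_all add: so_def eq_neg_iff_add_eq_0)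
  then obtain C' X where "C' \<in> I_minus" "X \<in> I_plus" "D = C' + X"
    using so4_decomposition by blast
  moreover from this have "M = block A 0 0 C' + block 0 B (- transpose B) X"
    by (simp add: b block_add \<open>C = - transpose B\<close>)
  ultimately show "M \<in> {Y + Z | Y Z. Y \<in> h_alg \<and> Z \<in> m_set}"
    using \<open>A \<in> so\<close> unfolding h_alg_def m_set_def by blast
next
  fix M :: "real^('n + 4)^('n + 4)"
  assume "M \<in> {Y + Z | Y Z. Y \<in> h_alg \<and> Z \<in> m_set}"
  then obtain B C D X where M: "M = block B 0 0 C + block 0 D (- transpose D) X"
    and *: "B \<in> so" "C \<in> I_minus" "X \<in> I_plus"
    by (auto simp: h_alg_def m_set_def)
  have "transpose (- transpose D) = - D"
    by (simp add: transpose_def vec_eq_iff)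
  moreover have "transpose B = - B" "transpose C = - C" "transpose X = - X"
    using * I_minus_so I_plus_so by (auto simp: so_transpose)
  ultimately have "M + transpose M = block 0 0 0 0"
    by (simp add: M block_add block_transpose transpose_add_mat)
  then show "M \<in> so"
    by (simp add: so_def block_0)
qed

theorem h_Int_m: "h_alg \<inter> m_set = {0 :: real^('n::finite + 4)^('n + 4)}"
proof -
  have 0: "(0 :: real^'n^'n) \<in> so" "- transpose (0 :: real^4^'n) = 0"
    by (simp_all add: so_def transpose_0_mat)
  have "M = 0" if M: "M \<in> h_alg" "M \<in> m_set" for M :: "real^('n + 4)^('n + 4)"
  proof -
    obtain B C where "M = block B 0 0 C" "C \<in> I_minus"
      using M(1) by (auto simp: h_alg_def)
    moreover obtain D X where "M = block 0 D (- transpose D) X" "X \<in> I_plus"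
      using M(2) by (auto simp: m_set_def)
    ultimately have "B = 0" "C \<in> I_minus \<inter> I_plus" "M = block B 0 0 C"
      by (auto simp: block_eq_iff)
    then show "M = 0"
      by (simp add: I_minus_Int_I_plus block_0)
  qed
  moreover have "block 0 0 0 0 \<in> (h_alg :: (real^('n + 4)^('n + 4)) set)"
    using 0(1) I_minus_Int_I_plus unfolding h_alg_def by blast
  moreover have "block 0 0 (- transpose 0) 0 \<in> (m_set :: (real^('n + 4)^('n + 4)) set)"
    using I_plus_0 unfolding m_set_def by blast
  ultimately show ?thesis
    by (auto simp: 0 block_0)
qed

lemma bracket_h_m:
  assumes "Y \<in> h_alg" "Z \<in> m_set"
  shows "bracket Y Z \<in> m_set"
proof -
  obtain B C where Y: "Y = block B 0 0 C" "B \<in> so" "C \<in> I_minus"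
    using assms(1) by (auto simp: h_alg_def)
  obtain D X where Z: "Z = block 0 D (- transpose D) X" "X \<in> I_plus"
    using assms(2) by (auto simp: m_set_def)
  have t: "transpose B = - B" "transpose C = - C"
    using Y I_minus_so by (auto simp: so_transpose)
  have c: "C ** X = X ** C"
    using Y Z Lmat_Rmat_commute by (auto simp: I_minus_def I_plus_def)
  have "bracket Y Z = block 0 (B ** D - D ** C) (- transpose (B ** D - D ** C)) 0"
    unfolding bracket_def Y(1) Z(1)
    by (simp add: block_mult block_diff block_eq_iff c transpose_diff_mat matrix_transpose_mul t
        minus_matrix_mult_left minus_matrix_mult_right)
  then show ?thesis
    unfolding m_set_def using I_plus_0 by blast
qed

lemma m_set_add: "Y \<in> m_set \<Longrightarrow> Z \<in> m_set \<Longrightarrow> Y + Z \<in> m_set"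
proof -
  assume "Y \<in> m_set" "Z \<in> m_set"
  then obtain D X D' X' where *: "Y = block 0 D (- transpose D) X" "X \<in> I_plus"
    "Z = block 0 D' (- transpose D') X'" "X' \<in> I_plus"
    by (auto simp: m_set_def)
  then have "Y + Z = block 0 (D + D') (- transpose (D + D')) (X + X')"
    by (simp add: block_add transpose_add_mat)
  then show ?thesis
    unfolding m_set_def using I_plus_add *(2,4) by blast
qed

lemma m_set_scale: "Y \<in> m_set \<Longrightarrow> c *\<^sub>R Y \<in> m_set"
proof -
  assume "Y \<in> m_set"
  then obtain D X where *: "Y = block 0 D (- transpose D) X" "X \<in> I_plus"
    by (auto simp: m_set_def)
  then have "c *\<^sub>R Y = block 0 (c *\<^sub>R D) (- transpose (c *\<^sub>R D)) (c *\<^sub>R X)"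
    by (simp add: block_scale transpose_scale_mat)
  then show ?thesis
    unfolding m_set_def using I_plus_scale *(2) by blast
qed

lemma m_set_0: "0 \<in> m_set"
  using h_Int_m by blast


subsection \<open>The space m as a real vector space, with the adjoint action\<close>

typedef (overloaded) 'n mspace = "m_set :: (real^('n::finite + 4)^('n + 4)) set"
  using m_set_0 by blast

setup_lifting type_definition_mspace

instantiation mspace :: (finite) real_vector
begin

lift_definition zero_mspace :: "'a mspace" is 0
  by (rule m_set_0)
lift_definition plus_mspace :: "'a mspace \<Rightarrow> 'a mspace \<Rightarrow> 'a mspace" is "(+)"
  by (rule m_set_add)
lift_definition minus_mspace :: "'a mspace \<Rightarrow> 'a mspace \<Rightarrow> 'a mspace" is "(-)"
  using m_set_add m_set_scale[of _ "-1"] by fastforce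
lift_definition uminus_mspace :: "'a mspace \<Rightarrow> 'a mspace" is uminus
  using m_set_scale[of _ "-1"] by fastforce
lift_definition scaleR_mspace :: "real \<Rightarrow> 'a mspace \<Rightarrow> 'a mspace" is scaleR
  by (rule m_set_scale)

instance
  by standard (transfer; simp add: algebra_simps)+

end

text \<open>Meaningful for \<open>X \<in> h_alg\<close> only, where the bracket preserves \<open>m_set\<close>.\<close>

definition ad :: "real^('n::finite + 4)^('n + 4) \<Rightarrow> 'n mspace \<Rightarrow> 'n mspace"
  where "ad X Y = Abs_mspace (bracket X (Rep_mspace Y))"

lemma Rep_ad: "X \<in> h_alg \<Longrightarrow> Rep_mspace (ad X Y) = bracket X (Rep_mspace Y)"
  unfolding ad_def by (intro Abs_mspace_inverse bracket_h_m Rep_mspace)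

lemma linear_ad:
  assumes "X \<in> h_alg"
  shows "linear (ad X)"
proof (rule linearI)
  fix Y Z :: "'a mspace" and c :: real
  have "Rep_mspace (ad X (Y + Z)) = Rep_mspace (ad X Y + ad X Z)"
    by (simp add: Rep_ad[OF assms] plus_mspace.rep_eq bracket_def matrix_add_ldistrib matrix_add_rdistrib')
  then show "ad X (Y + Z) = ad X Y + ad X Z"
    by (simp add: Rep_mspace_inject)
  have "Rep_mspace (ad X (c *\<^sub>R Y)) = Rep_mspace (c *\<^sub>R ad X Y)"
    by (simp add: Rep_ad[OF assms] scaleR_mspace.rep_eq bracket_def matrix_scaleR_left'
        matrix_scaleR_right' scaleR_diff_right)
  then show "ad X (c *\<^sub>R Y) = c *\<^sub>R ad X Y"
    by (simp add: Rep_mspace_inject)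
qed

end

theory Submission
  imports Defs
begin

text \<open>
  As a module over \<open>\<hh> = so(n) \<oplus> sp(1)\<close>, the space \<open>\<mm>\<close> splits as \<open>W \<oplus> T\<close>. Here \<open>W\<close> is the space of
  \<open>n \<times> 4\<close> matrices, whose rows are quaternions; \<open>so(n)\<close> acts on it by matrix multiplication from the
  left and \<open>sp(1)\<close> by quaternion multiplication of all rows from the right. The summand
  \<open>T = I\<^sup>+ \<cong> \<real>\<^sup>3\<close> is a trivial module.

  The standard inner product on \<open>W \<oplus> T\<close> is invariant, and it turns each of the three spaces of
  homomorphisms into a space of invariant trilinear forms \<open>\<tau>\<close> on \<open>\<mm>\<close>: all of them for
  \<open>\<mm> \<otimes> \<mm> \<rightarrow> \<mm>\<close>, those skew in the last two arguments for \<open>\<mm> \<rightarrow> \<Lambda>\<^sup>2\<mm>\<close>, and the alternating ones for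
  \<open>\<Lambda>\<^sup>3\<mm> \<rightarrow> \<real>\<close> (lemmas \<open>tensor_form_image\<close>, \<open>ext2_form_image\<close>, \<open>ext3_form_image\<close>). So everything reduces
  to the classification of invariant trilinear forms (\<open>invariant_form_classification\<close>).

  Restrict such a form to arguments from \<open>W\<close> and \<open>T\<close>. A quaternion unit of \<open>sp(1)\<close> acts on \<open>W\<close> as a
  complex structure \<open>J\<close>, and this forces the form to vanish when the number of arguments from \<open>W\<close> is odd.
  With exactly two arguments from \<open>W\<close> one gets, for each fixed element of \<open>T\<close>, an invariant bilinear form
  on \<open>W\<close>, that is, an operator that commutes with \<open>\<hh>\<close>. For \<open>n \<ge> 3\<close> these operators are the
  left multiplications of the rows by a quaternion (\<open>commutant_of_h\<close>), so each of the three positions of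
  the argument from \<open>T\<close> contributes a linear map \<open>\<real>\<^sup>3 \<rightarrow> \<real>\<^sup>4\<close>. On \<open>T\<close> alone the form is arbitrary.
  This gives \<open>3 \<cdot> 12 + 27 = 63\<close> parameters.

  Exchanging two arguments of a form acts on the parameters by permuting the three maps
  \<open>\<real>\<^sup>3 \<rightarrow> \<real>\<^sup>4\<close>, conjugating the one for which the two exchanged arguments both lie in \<open>W\<close>. Skewness in
  the last two arguments hence leaves one free map \<open>\<real>\<^sup>3 \<rightarrow> \<real>\<^sup>4\<close>, one map \<open>\<real>\<^sup>3 \<rightarrow> \<real>\<^sup>3\<close> into the imaginary
  quaternions and an element of \<open>T \<otimes> \<Lambda>\<^sup>2T\<close>, which is \<open>12 + 9 + 9 = 30\<close>. Full skewness leaves one map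
  \<open>\<real>\<^sup>3 \<rightarrow> \<real>\<^sup>3\<close> and an element of \<open>\<Lambda>\<^sup>3T\<close>, which is \<open>9 + 1 = 10\<close>.
\<close>

section \<open>A dimension count by parametrization\<close>

text \<open>
  The space \<open>S\<close> of homomorphisms lies in a function type, where no basis is at hand. A linear embedding \<open>G\<close>
  of \<open>S\<close> and a linear parametrization \<open>\<Phi>\<close> of the same image carry the standard basis of the
  parameter space back to a basis of \<open>S\<close>.
\<close>

lemma dim_eq_DIM_if_same_image:
  fixes G :: "'a::real_vector \<Rightarrow> 'b::real_vector" and \<Phi> :: "'p::euclidean_space \<Rightarrow> 'b"
  assumes G: "linear G" "inj_on G S" and S: "subspace S"
    and \<Phi>: "linear \<Phi>" "inj \<Phi>" and eq: "G ` S = range \<Phi>"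
  shows "dim S = DIM('p)"
proof -
  define B where "B = inv_into S G ` \<Phi> ` Basis"
  have GB: "G ` B = \<Phi> ` Basis"
  proof -
    have "G (inv_into S G (\<Phi> b)) = \<Phi> b" for b
      by (rule f_inv_into_f) (simp add: eq)
    then show ?thesis
      by (simp add: B_def image_image)
  qed
  have BS: "B \<subseteq> S"
    unfolding B_def using eq by (auto intro!: inv_into_into)
  have ind: "independent (G ` B)"
    unfolding GB
    by (rule linear_independent_injective_image[OF \<Phi>(1) independent_Basis inj_on_subset[OF \<Phi>(2) subset_UNIV]])
  have inj: "inj_on G B"
    by (rule inj_on_subset[OF G(2) BS])
  have "independent B"
  proof (rule ccontr)
    assume "\<not> independent B"
    then obtain a where a: "a \<in> B" "a \<in> span (B - {a})"
      by (auto simp: dependent_def)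
    have "G a \<in> span (G ` (B - {a}))"
      using a(2) linear_span_image[OF G(1)] by blast
    moreover have "G ` (B - {a}) = G ` B - {G a}"
      using inj_on_image_set_diff[OF inj, of B "{a}"] a(1) by simp
    ultimately show False
      using ind a(1) by (auto simp: dependent_def)
  qed
  moreover have "span B = span S"
  proof
    show "span B \<subseteq> span S" by (rule span_mono[OF BS])
    show "span S \<subseteq> span B"
    proof
      fix s assume "s \<in> span S"
      then have s: "s \<in> S" using S by (metis span_eq_iff)
      then have "G s \<in> range \<Phi>" using eq by blast
      also have "range \<Phi> = \<Phi> ` span Basis" by simp
      also have "\<dots> = span (G ` B)" unfolding GB by (rule linear_span_image[OF \<Phi>(1), symmetric])
      also have "\<dots> = G ` span B" by (rule linear_span_image[OF G(1)])
      finally obtain s' where s': "G s = G s'" "s' \<in> span B" by blast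
      have "s' \<in> S" using s'(2) BS S span_minimal by blast
      with s s' G(2) show "s \<in> span B" by (auto dest: inj_onD)
    qed
  qed
  ultimately have "dim S = card B" by (intro dim_eq_card)
  also have "\<dots> = card (\<Phi> ` Basis)" using card_image[OF inj] GB by simp
  also have "\<dots> = DIM('p)" using card_image[OF inj_on_subset[OF \<Phi>(2) subset_UNIV]] by blast
  finally show ?thesis .
qed

section \<open>The module W of quaternionic rows\<close>

definition rmul :: "real^4 \<Rightarrow> real^4^'n::finite \<Rightarrow> real^4^'n"
  where "rmul p D = (\<chi> a. qmult (D $ a) p)"

definition lmul :: "real^4 \<Rightarrow> real^4^'n::finite \<Rightarrow> real^4^'n"
  where "lmul q D = (\<chi> a. qmult q (D $ a))"

text \<open>
  The action of \<open>\<hh>\<close> on \<open>W\<close>. For imaginary \<open>p\<close> right multiplication by \<open>p\<close> on quaternions is skew, so the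
  bracket, which multiplies by the matrix \<open>- Rmat p\<close> from the right, multiplies each row by \<open>p\<close>.
\<close>

definition hact :: "real^'n^'n \<Rightarrow> real^4 \<Rightarrow> real^4^'n::finite \<Rightarrow> real^4^'n"
  where "hact B p D = B ** D + rmul p D"

definition qconj :: "real^4 \<Rightarrow> real^4"
  where "qconj q = vector [q$1, - q$2, - q$3, - q$4]"

lemma bilinear_qmult: "bilinear qmult"
  unfolding bilinear_def
  by (auto intro!: linearI simp: qmult_def vec_eq_iff forall_4 algebra_simps)

lemmas qmult_simps = bilinear_ladd[OF bilinear_qmult] bilinear_radd[OF bilinear_qmult]
  bilinear_lmul[OF bilinear_qmult] bilinear_rmul[OF bilinear_qmult]
  bilinear_lzero[OF bilinear_qmult] bilinear_rzero[OF bilinear_qmult]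

lemma qmult_sum_right: "qmult q (\<Sum>a\<in>A. x a) = (\<Sum>a\<in>A. qmult q (x a))"
  using linear_sum[of "qmult q"] bilinear_qmult by (simp add: bilinear_def)

lemma bilinear_left_mult: "bilinear lmul"
  unfolding bilinear_def
  by (auto intro!: linearI simp: lmul_def vec_eq_iff[where 'a = "real^4"] qmult_simps)

lemma linear_rmul: "linear (rmul p)"
  by (auto intro!: linearI simp: rmul_def vec_eq_iff[where 'a = "real^4"] qmult_simps)

lemma qmult_one: "qmult (axis 1 1) q = q" "qmult q (axis 1 1) = q"
  by (simp_all add: qmult_def vec_eq_iff forall_4 axis_def)

lemma linear_hact: "linear (hact B p)"
  unfolding hact_def
  by (intro linear_compose_add linear_rmul)
     (auto intro!: linearI simp: matrix_add_ldistrib matrix_scaleR_right')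

lemma matrix_mult_row: "(B ** D) $ a = (\<Sum>b\<in>UNIV. B $ a $ b *\<^sub>R D $ b)"
  for B :: "real^'n^'m" and D :: "real^4^'n"
  by (simp add: vec_eq_iff matrix_matrix_mult_def)

lemma hact_lmul: "hact B p (lmul q D) = lmul q (hact B p D)"
  by (simp add: vec_eq_iff[where 'a = "real^4"] hact_def lmul_def rmul_def matrix_mult_row
      qmult_assoc qmult_sum_right qmult_simps)

lemma rmul_eq_mult_Rmat:
  assumes "p \<in> imaginary"
  shows "D ** Rmat p = - rmul p D"
  using assms by (simp add: vec_eq_iff forall_4 matrix_matrix_mult_def sum_4 Rmat_nth rmul_def
      qmult_def axis_def imaginary_def)

lemma rmul_skew:
  assumes "p \<in> imaginary"
  shows "rmul p D \<bullet> D' = - (D \<bullet> rmul p D')"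
  using assms by (simp add: inner_vec_def sum_4 rmul_def qmult_def imaginary_def
       flip: sum_negf) (simp add: algebra_simps)

lemma so_mult_skew:
  fixes B :: "real^'n^'n" and D :: "real^4^'n"
  assumes "B \<in> so"
  shows "(B ** D) \<bullet> D' = - (D \<bullet> (B ** D'))"
proof -
  have B: "B $ a $ b = - B $ b $ a" for a b
  proof -
    have "transpose B $ b $ a = - B $ b $ a"
      using assms by (simp add: so_transpose)
    then show ?thesis by (simp add: transpose_def)
  qed
  have "(B ** D) \<bullet> D' = (\<Sum>a\<in>UNIV. \<Sum>b\<in>UNIV. B $ a $ b * (D $ b \<bullet> D' $ a))"
    by (simp add: inner_vec_def[of "B ** D"] matrix_mult_row inner_sum_left)
  also have "\<dots> = (\<Sum>b\<in>UNIV. \<Sum>a\<in>UNIV. B $ a $ b * (D $ b \<bullet> D' $ a))"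
    by (rule sum.swap)
  also have "\<dots> = (\<Sum>b\<in>UNIV. \<Sum>a\<in>UNIV. - (B $ b $ a * (D $ b \<bullet> D' $ a)))"
    by (intro sum.cong refl) (subst B, simp)
  also have "\<dots> = - (D \<bullet> (B ** D'))"
    by (simp add: inner_vec_def[of D] matrix_mult_row inner_sum_right sum_negf)
  finally show ?thesis .
qed

lemma hact_skew:
  assumes "B \<in> so" "p \<in> imaginary"
  shows "hact B p D \<bullet> D' = - (D \<bullet> hact B p D')"
  using so_mult_skew[OF assms(1), of D D'] rmul_skew[OF assms(2), of D D']
  by (simp add: hact_def inner_add_left inner_add_right)

lemma lmul_adjoint: "lmul q D \<bullet> D' = D \<bullet> lmul (qconj q) D'"
  by (simp add: inner_vec_def sum_4 lmul_def qmult_def qconj_def algebra_simps)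

lemma h_algE:
  assumes "X \<in> h_alg"
  obtains B p where "X = block B 0 0 (Rmat p)" "B \<in> so" "p \<in> imaginary"
  using assms by (auto simp: h_alg_def I_minus_def)

text \<open>
  \<open>E\<^sub>a\<^sub>b - E\<^sub>b\<^sub>a\<close> in terms of matrix units, the infinitesimal rotation in the plane of the coordinates \<open>a\<close> and \<open>b\<close>.
\<close>

definition rot :: "'n \<Rightarrow> 'n \<Rightarrow> real^'n^'n::finite"
  where "rot a b = (\<chi> i j. (if i = a \<and> j = b then 1 else 0) - (if i = b \<and> j = a then 1 else 0))"

lemma rot_so: "rot a b \<in> so"
proof -
  have "(rot a b + transpose (rot a b)) $ i $ j = 0" for i j
    unfolding rot_def transpose_def vector_add_component vec_lambda_beta conj_commute[of "j = _" "i = _"]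
    by (simp only: diff_add_cancel add_diff_eq cancel_comm_monoid_add_class.diff_cancel diff_self)
  then show ?thesis unfolding so_def mem_Collect_eq vec_eq_iff by (simp only: zero_index simp_thms)
qed

lemma rot_mult:
  fixes D :: "real^4^'n::finite"
  assumes "a \<noteq> b"
  shows "rot a b ** D = (\<chi> i. if i = a then D $ b else if i = b then - D $ a else 0)"
proof -
  have 1: "(\<Sum>j\<in>UNIV. (if P \<and> j = c then 1 else 0) *\<^sub>R D $ j) = (if P then D $ c else 0)" for P c
  proof -
    have "(\<Sum>j\<in>UNIV. (if P \<and> j = c then 1 else 0) *\<^sub>R D $ j) = (\<Sum>j\<in>UNIV. if j = c then (if P then D $ j else 0) else 0)"
      by (intro sum.cong refl) simp
    then show ?thesis by simp
  qed
  have "(rot a b ** D) $ i = (if i = a then D $ b else 0) - (if i = b then D $ a else 0)" for i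
    unfolding matrix_mult_row rot_def by (simp only: vec_lambda_beta scaleR_diff_left sum_subtractf 1)
  then show ?thesis using assms by (simp add: vec_eq_iff[where 'a = "real^4"])
qed

text \<open>
  Write \<open>e\<^sub>a x\<close> for the matrix with the quaternion \<open>x\<close> in row \<open>a\<close> and zeros elsewhere. Rotations in planes that avoid
  \<open>a\<close> annihilate \<open>e\<^sub>a x\<close>, so \<open>f\<close> preserves the rows; the rotation that moves row \<open>b\<close> to row \<open>a\<close> shows that
  \<open>f\<close> is the same quaternionic map \<open>g\<close> on all rows; and \<open>g\<close> commutes with right multiplications,
  hence is left multiplication by \<open>g 1\<close>. For \<open>n = 2\<close> the rotation in the only plane is itself a further
  element of the commutant.
\<close>

theorem commutant_of_h:
  fixes f :: "real^4^'n::finite \<Rightarrow> real^4^'n"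
  assumes n: "CARD('n) \<ge> 3" and f: "linear f"
    and com: "\<And>B p D. B \<in> so \<Longrightarrow> p \<in> imaginary \<Longrightarrow> f (hact B p D) = hact B p (f D)"
  shows "\<exists>q. f = lmul q"
proof -
  let ?e = "\<lambda>a x. axis a x :: real^4^'n"
  have rot: "f (rot a b ** D) = rot a b ** f D" for a b D
  proof -
    have "hact B 0 D = B ** D" for B and D :: "real^4^'n"
      by (simp add: hact_def rmul_def qmult_simps vec_eq_iff)
    then show ?thesis using com[OF rot_so, of 0 a b D] by (simp add: imaginary_def)
  qed
  have rmul: "f (rmul p D) = rmul p (f D)" if "p \<in> imaginary" for p D
  proof -
    have "hact 0 p D = rmul p D" for D :: "real^4^'n"
      by (simp add: hact_def vec_eq_iff matrix_matrix_mult_def)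
    moreover have "0 \<in> (so :: (real^'n^'n) set)"
      by (simp add: so_def transpose_0_mat)
    ultimately show ?thesis
      using com[of 0 p D] that by simp
  qed
  have row: "f (?e a x) $ b = 0" if "b \<noteq> a" for a b x
  proof -
    \<comment> \<open>As \<open>n \<ge> 3\<close>, there is a plane through \<open>b\<close> that avoids \<open>a\<close>.\<close>
    have "card {a, b} \<noteq> CARD('n)"
      using n that by simp
    then have "{a, b} \<noteq> UNIV" by (rule contrapos_nn) (rule arg_cong)
    then obtain c where "c \<notin> {a, b}" by blast
    then have c: "c \<noteq> a" "c \<noteq> b" by simp_all
    have "rot c b ** ?e a x = 0"
      using c that by (simp add: rot_mult vec_eq_iff axis_def)
    then have "(rot c b ** f (?e a x)) $ c = 0"
      using rot[of c b "?e a x"] linear_0[OF f] by simp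
    then show ?thesis using c by (simp add: rot_mult)
  qed
  define g where "g a x = f (?e a x) $ a" for a x
  have fe: "f (?e a x) = ?e a (g a x)" for a x
  proof -
    have "f (?e a x) $ b = ?e a (g a x) $ b" for b
      using row[of b a x] by (cases "b = a") (simp_all add: g_def axis_def)
    then show ?thesis unfolding vec_eq_iff by blast
  qed
  have g_indep: "g a x = g b x" for a b x
  proof (cases "a = b")
    case False
    have e: "rot a b ** ?e b y = ?e a y" for y
      using False by (simp add: rot_mult vec_eq_iff axis_def)
    have "?e a (g a x) = ?e a (g b x)"
      using rot[of a b "?e b x"] by (simp add: e fe)
    then show ?thesis by (auto simp: axis_eq_axis)
  qed simp
  obtain a0 :: 'n where True by simp
  define q where "q = g a0 (axis 1 1)"
  have re: "rmul p (?e a x) = ?e a (qmult x p)" for p a x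
    by (simp add: vec_eq_iff rmul_def axis_def qmult_simps)
  have glin: "linear (g a)" for a
  proof -
    have "?e a (x + y) = ?e a x + ?e a y" "?e a (c *\<^sub>R x) = c *\<^sub>R ?e a x" for x y c
      by (simp_all add: vec_eq_iff axis_def)
    then show ?thesis
      by (intro linearI) (simp_all add: g_def linear_add[OF f] linear_scale[OF f])
  qed
  have gR: "g a (qmult x p) = qmult (g a x) p" if "p \<in> imaginary" for a x p
    using rmul[OF that, of "?e a x"] by (auto simp: re fe axis_eq_axis qmult_simps)
  have g: "g a x = qmult q x" for a x
  proof -
    \<comment> \<open>Right multiplication by reals commutes with \<open>g\<close> by linearity, so the imaginary part decides.\<close>
    define p where "p = x - (x$1) *\<^sub>R axis 1 1"
    have p: "p \<in> imaginary" "x = (x$1) *\<^sub>R axis 1 1 + p"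
      by (simp_all add: p_def imaginary_def)
    have "g a x = (x$1) *\<^sub>R q + g a p"
      by (subst p(2)) (simp add: linear_add[OF glin] linear_scale[OF glin] q_def g_indep[of a0 _ a])
    also have "g a p = qmult q p"
      using gR[OF p(1), of a "axis 1 1"] by (simp add: qmult_one q_def g_indep[of a0 _ a])
    also have "(x$1) *\<^sub>R q + qmult q p = qmult q x"
      by (subst (2) p(2)) (simp add: qmult_simps qmult_one)
    finally show ?thesis .
  qed
  have "f D = lmul q D" for D
  proof -
    have "D = (\<Sum>a\<in>UNIV. ?e a (D $ a))"
      by (simp add: vec_eq_iff axis_def if_distrib[of "\<lambda>x. x $ _"] cong: if_cong)
    then have "f D = f (\<Sum>a\<in>UNIV. ?e a (D $ a))"
      by (rule arg_cong)
    also have "\<dots> = (\<Sum>a\<in>UNIV. ?e a (qmult q (D $ a)))"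
      by (simp add: linear_sum[OF f] fe g)
    also have "\<dots> = lmul q D"
      by (simp add: lmul_def vec_eq_iff axis_def if_distrib[of "\<lambda>x. x $ _"] cong: if_cong)
    finally show ?thesis .
  qed
  then show ?thesis by blast
qed

text \<open>
  The action on \<open>W\<close> is skew, so the operator that represents an invariant bilinear form by means of the
  inner product commutes with the action.
\<close>

lemma invariant_bilinear_form:
  fixes b :: "real^4^'n::finite \<Rightarrow> real^4^'n \<Rightarrow> real"
  assumes n: "CARD('n) \<ge> 3" and b: "bilinear b"
    and inv: "\<And>B p D D'. B \<in> so \<Longrightarrow> p \<in> imaginary \<Longrightarrow> b (hact B p D) D' + b D (hact B p D') = 0"
  shows "\<exists>q. \<forall>D D'. b D D' = lmul q D \<bullet> D'"
proof -
  define f where "f D = (\<Sum>e\<in>Basis. b D e *\<^sub>R e)" for D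
  have lin: "linear (b D)" for D
    using b by (simp add: bilinear_def)
  have f: "f D \<bullet> D' = b D D'" for D D'
  proof -
    have "f D \<bullet> D' = (\<Sum>e\<in>Basis. (D' \<bullet> e) * b D e)"
      by (simp add: f_def inner_sum_left inner_commute[of D'] mult.commute)
    also have "\<dots> = b D (\<Sum>e\<in>Basis. (D' \<bullet> e) *\<^sub>R e)"
      by (simp add: linear_sum[OF lin] linear_scale[OF lin])
    finally show ?thesis by (simp add: euclidean_representation)
  qed
  have "linear f"
    by (intro linearI) (simp_all add: f_def bilinear_ladd[OF b] bilinear_lmul[OF b]
      scaleR_add_left sum.distrib scaleR_sum_right)
  moreover have "f (hact B p D) = hact B p (f D)" if "B \<in> so" "p \<in> imaginary" for B p D
  proof (rule vector_eq_rdot[THEN iffD1], rule allI)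
    fix D' show "f (hact B p D) \<bullet> D' = hact B p (f D) \<bullet> D'"
      using inv[OF that, of D D'] by (simp add: hact_skew[OF that] f)
  qed
  ultimately obtain q where "f = lmul q"
    using commutant_of_h[OF n] by blast
  then show ?thesis using f by metis
qed

lemma lmul_form_eq_0D:
  fixes q :: "real^4"
  assumes "\<And>D D' :: real^4^'n::finite. lmul q D \<bullet> D' = 0"
  shows "q = 0"
proof -
  have "lmul q (axis a (axis 1 1)) = (axis a q :: real^4^'n)" for a
    by (simp add: lmul_def vec_eq_iff[where 'a = "real^4"] axis_def[of a] qmult_one qmult_simps)
  then have "axis a q \<bullet> (axis a q :: real^4^'n) = 0" for a
    using assms by metis
  then show ?thesis by simp
qed

section \<open>Trilinear forms\<close>

definition trilinear :: "('a::real_vector \<Rightarrow> 'a \<Rightarrow> 'a \<Rightarrow> real) \<Rightarrow> bool"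
  where "trilinear \<tau> \<longleftrightarrow> (\<forall>y z. linear (\<lambda>x. \<tau> x y z)) \<and> (\<forall>x z. linear (\<lambda>y. \<tau> x y z))
    \<and> (\<forall>x y. linear (\<lambda>z. \<tau> x y z))"

lemma trilinearD:
  assumes "trilinear \<tau>"
  shows "linear (\<lambda>x. \<tau> x y z)" "linear (\<lambda>y. \<tau> x y z)" "linear (\<lambda>z. \<tau> x y z)"
  using assms by (simp_all add: trilinear_def)

lemma trilinear_simps:
  assumes "trilinear \<tau>"
  shows "\<tau> (x + x') y z = \<tau> x y z + \<tau> x' y z" "\<tau> x (y + y') z = \<tau> x y z + \<tau> x y' z"
    "\<tau> x y (z + z') = \<tau> x y z + \<tau> x y z'"
    "\<tau> (c *\<^sub>R x) y z = c * \<tau> x y z" "\<tau> x (c *\<^sub>R y) z = c * \<tau> x y z" "\<tau> x y (c *\<^sub>R z) = c * \<tau> x y z"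
    "\<tau> 0 y z = 0" "\<tau> x 0 z = 0" "\<tau> x y 0 = 0"
    "\<tau> (- x) y z = - \<tau> x y z" "\<tau> x (- y) z = - \<tau> x y z" "\<tau> x y (- z) = - \<tau> x y z"
    "\<tau> (sum f A) y z = (\<Sum>a\<in>A. \<tau> (f a) y z)" "\<tau> x (sum f A) z = (\<Sum>a\<in>A. \<tau> x (f a) z)"
    "\<tau> x y (sum f A) = (\<Sum>a\<in>A. \<tau> x y (f a))"
  by (simp_all add: linear_add[OF trilinearD(1)[OF assms]] linear_add[OF trilinearD(2)[OF assms]]
      linear_add[OF trilinearD(3)[OF assms]] linear_scale[OF trilinearD(1)[OF assms]]
      linear_scale[OF trilinearD(2)[OF assms]] linear_scale[OF trilinearD(3)[OF assms]]
      linear_0[OF trilinearD(1)[OF assms]] linear_0[OF trilinearD(2)[OF assms]] linear_0[OF trilinearD(3)[OF assms]]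
      linear_neg[OF trilinearD(1)[OF assms]] linear_neg[OF trilinearD(2)[OF assms]] linear_neg[OF trilinearD(3)[OF assms]]
      linear_sum[OF trilinearD(1)[OF assms]] linear_sum[OF trilinearD(2)[OF assms]] linear_sum[OF trilinearD(3)[OF assms]])

lemma trilinear_permute:
  assumes "trilinear \<tau>"
  shows "trilinear (\<lambda>x y z. \<tau> x z y)" "trilinear (\<lambda>x y z. \<tau> y x z)" "trilinear (\<lambda>x y z. \<tau> z x y)"
  using assms by (simp_all add: trilinear_def)

text \<open>
  On the complexification \<open>J\<close> has the eigenvalues \<open>\<plusminus>\<i>\<close>, and a sum of three of them is never \<open>0\<close>. In real
  terms, invariance applied twice gives \<open>t (J x) (J y) z = t x y z / 2\<close>. Iterating this
  divides by \<open>4\<close>, while \<open>J (J x) = - x\<close> in both arguments changes nothing.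
\<close>

lemma complex_structure_invariant_trilinear_eq_0:
  fixes t :: "'a::real_vector \<Rightarrow> 'a \<Rightarrow> 'a \<Rightarrow> real"
  assumes t: "trilinear t" and J: "\<And>x. J (J x) = - x"
    and inv: "\<And>x y z. t (J x) y z + t x (J y) z + t x y (J z) = 0"
  shows "t x y z = 0"
proof -
  have half: "t (J x) (J y) z = t x y z / 2" for x y z
    using inv[of x y "J z"] inv[of "J x" y z] inv[of x "J y" z]
    by (simp add: J trilinear_simps[OF t])
  show ?thesis
    using half[of x y z] half[of "J x" "J y" z] by (simp add: J trilinear_simps[OF t])
qed

section \<open>Coordinates on m\<close>

definition imq :: "real^3 \<Rightarrow> real^4"
  where "imq t = vector [0, t$1, t$2, t$3]"

lemma imq_nth [simp]: "imq t $ 1 = 0" "imq t $ 2 = t $ 1" "imq t $ 3 = t $ 2" "imq t $ 4 = t $ 3"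
  by (simp_all add: imq_def)

definition mk :: "real^4^'n::finite \<Rightarrow> real^3 \<Rightarrow> 'n mspace"
  where "mk D t = Abs_mspace (block 0 D (- transpose D) (Lmat (imq t)))"

definition wpart :: "'n::finite mspace \<Rightarrow> real^4^'n"
  where "wpart Y = (\<chi> a b. Rep_mspace Y $ Inl a $ Inr b)"

text \<open>
  The first column of the matrix of left multiplication by \<open>q\<close> is \<open>q\<close> itself, from which the component in \<open>T\<close>
  is read off.
\<close>

definition tpart :: "'n::finite mspace \<Rightarrow> real^3"
  where "tpart Y = vector [Rep_mspace Y $ Inr 2 $ Inr 1, Rep_mspace Y $ Inr 3 $ Inr 1, Rep_mspace Y $ Inr 4 $ Inr 1]"

lemma Rep_mk: "Rep_mspace (mk D t) = block 0 D (- transpose D) (Lmat (imq t))"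
proof -
  have "imq t \<in> imaginary" by (simp add: imaginary_def)
  then show ?thesis
    unfolding mk_def by (intro Abs_mspace_inverse) (auto simp: m_set_def I_plus_def)
qed

lemma wpart_mk [simp]: "wpart (mk D t) = D"
  by (simp add: wpart_def Rep_mk block_def vec_eq_iff)

lemma tpart_mk [simp]: "tpart (mk D t) = t"
  by (simp add: tpart_def Rep_mk block_def vec_eq_iff forall_3 Lmat_nth qmult_def axis_def)

lemma mk_wpart_tpart: "mk (wpart Y) (tpart Y) = Y"
proof -
  obtain D X where DX: "Rep_mspace Y = block 0 D (- transpose D) X" "X \<in> I_plus"
    using Rep_mspace[of Y] by (auto simp: m_set_def)
  then obtain p where p: "X = Lmat p" "p \<in> imaginary"
    by (auto simp: I_plus_def)
  have "p = imq (vector [p$2, p$3, p$4])"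
    using p(2) by (simp add: vec_eq_iff forall_4 imaginary_def)
  then obtain t where t: "p = imq t" by blast
  have "Y = mk D t"
    using DX p t by (simp add: Rep_mk flip: Rep_mspace_inject)
  then show ?thesis by simp
qed

lemma mspace_eq_iff: "Y = Z \<longleftrightarrow> wpart Y = wpart Z \<and> tpart Y = tpart Z"
  by (metis mk_wpart_tpart)

lemma linear_wpart: "linear wpart"
  by (intro linearI) (simp_all add: wpart_def vec_eq_iff plus_mspace.rep_eq scaleR_mspace.rep_eq)

lemma linear_tpart: "linear tpart"
  by (intro linearI) (simp_all add: tpart_def vec_eq_iff forall_3 plus_mspace.rep_eq scaleR_mspace.rep_eq)

lemmas part_simps [simp] = linear_add[OF linear_wpart] linear_scale[OF linear_wpart] linear_0[OF linear_wpart]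
  linear_add[OF linear_tpart] linear_scale[OF linear_tpart] linear_0[OF linear_tpart]

lemma mk_add: "mk D t + mk D' t' = mk (D + D') (t + t')"
  by (simp add: mspace_eq_iff)

lemma mk_scale: "c *\<^sub>R mk D t = mk (c *\<^sub>R D) (c *\<^sub>R t)"
  by (simp add: mspace_eq_iff)

lemma mk_0 [simp]: "mk 0 0 = 0"
  by (simp add: mspace_eq_iff)

lemma ad_eq:
  assumes B: "B \<in> so" and p: "p \<in> imaginary"
  shows "ad (block B 0 0 (Rmat p)) Y = mk (hact B p (wpart Y)) 0"
proof -
  let ?D = "wpart Y"
  have C: "Rmat p \<in> I_minus" using p by (auto simp: I_minus_def)
  have X: "block B 0 0 (Rmat p) \<in> h_alg" using B C unfolding h_alg_def by blast
  have t: "transpose B = - B" "transpose (Rmat p) = - Rmat p"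
    using B C I_minus_so by (auto simp: so_transpose)
  have Y: "Rep_mspace Y = block 0 ?D (- transpose ?D) (Lmat (imq (tpart Y)))"
    by (metis Rep_mk mk_wpart_tpart)
  have r: "rmul p ?D = - (?D ** Rmat p)"
    by (simp add: rmul_eq_mult_Rmat[OF p])
  have neg: "transpose (- A) = - transpose A" for A :: "real^4^'a"
    by (simp add: transpose_def vec_eq_iff)
  have "Lmat (imq 0) = 0"
    by (simp add: vec_eq_iff Lmat_nth qmult_def forall_4)
  then have "bracket (block B 0 0 (Rmat p)) (Rep_mspace Y)
      = block 0 (hact B p ?D) (- transpose (hact B p ?D)) (Lmat (imq 0))"
    unfolding bracket_def Y hact_def
    by (simp add: block_mult block_diff block_eq_iff Lmat_Rmat_commute matrix_transpose_mul t
        minus_matrix_mult_left minus_matrix_mult_right r neg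
        transpose_add_mat transpose_diff_mat)
  then show ?thesis
    by (simp add: Rep_ad[OF X] Rep_mk flip: Rep_mspace_inject)
qed

section \<open>Classification of invariant trilinear forms\<close>

definition invariant_form :: "('n::finite mspace \<Rightarrow> 'n mspace \<Rightarrow> 'n mspace \<Rightarrow> real) \<Rightarrow> bool"
  where "invariant_form \<tau> \<longleftrightarrow> trilinear \<tau> \<and>
    (\<forall>X\<in>h_alg. \<forall>x y z. \<tau> (ad X x) y z + \<tau> x (ad X y) z + \<tau> x y (ad X z) = 0)"

lemma invariant_form_iff:
  "invariant_form \<tau> \<longleftrightarrow> trilinear \<tau> \<and> (\<forall>B p x y z. B \<in> so \<longrightarrow> p \<in> imaginary \<longrightarrow>
    \<tau> (mk (hact B p (wpart x)) 0) y z + \<tau> x (mk (hact B p (wpart y)) 0) z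
      + \<tau> x y (mk (hact B p (wpart z)) 0) = 0)"
proof -
  have "block B 0 0 (Rmat p) \<in> h_alg" if "B \<in> so" "p \<in> imaginary" for B :: "real^'a^'a" and p
    using that unfolding h_alg_def I_minus_def by blast
  then show ?thesis
    unfolding invariant_form_def by (metis (no_types, lifting) ad_eq h_algE)
qed

lemma invariant_form_permute:
  assumes "invariant_form \<tau>"
  shows "invariant_form (\<lambda>x y z. \<tau> x z y)" "invariant_form (\<lambda>x y z. \<tau> y x z)"
    "invariant_form (\<lambda>x y z. \<tau> z x y)"
proof -
  have tri: "trilinear \<tau>"
    using assms by (simp add: invariant_form_def)
  have inv: "\<tau> (ad X x) y z + \<tau> x (ad X y) z + \<tau> x y (ad X z) = 0" if "X \<in> h_alg" for X x y z
    using assms that by (simp add: invariant_form_def)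
  show "invariant_form (\<lambda>x y z. \<tau> x z y)"
    unfolding invariant_form_def
  proof (intro conjI ballI allI)
    show "trilinear (\<lambda>x y z. \<tau> x z y)" by (rule trilinear_permute(1)[OF tri])
  next
    fix X :: "real^('a + 4)^('a + 4)" and x y z assume "X \<in> h_alg"
    from inv[OF this, of x z y] show "\<tau> (ad X x) z y + \<tau> x z (ad X y) + \<tau> x (ad X z) y = 0" by linarith
  qed
  show "invariant_form (\<lambda>x y z. \<tau> y x z)"
    unfolding invariant_form_def
  proof (intro conjI ballI allI)
    show "trilinear (\<lambda>x y z. \<tau> y x z)" by (rule trilinear_permute(2)[OF tri])
  next
    fix X :: "real^('a + 4)^('a + 4)" and x y z assume "X \<in> h_alg"
    from inv[OF this, of y x z] show "\<tau> y (ad X x) z + \<tau> (ad X y) x z + \<tau> y x (ad X z) = 0" by linarith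
  qed
  show "invariant_form (\<lambda>x y z. \<tau> z x y)"
    unfolding invariant_form_def
  proof (intro conjI ballI allI)
    show "trilinear (\<lambda>x y z. \<tau> z x y)" by (rule trilinear_permute(3)[OF tri])
  next
    fix X :: "real^('a + 4)^('a + 4)" and x y z assume "X \<in> h_alg"
    from inv[OF this, of z x y] show "\<tau> z (ad X x) y + \<tau> z x (ad X y) + \<tau> (ad X z) x y = 0" by linarith
  qed
qed

lemma hact_0 [simp]: "hact B p 0 = 0"
  by (rule linear_0[OF linear_hact])

lemma vector_matrix_mult_rows: "t v* q = (\<Sum>i\<in>UNIV. t $ i *\<^sub>R q $ i)" for q :: "real^'m^'k::finite"
  by (simp add: vec_eq_iff vector_matrix_mult_def mult.commute)

definition pairing :: "real^4^3 \<Rightarrow> real^3 \<Rightarrow> real^4^'n::finite \<Rightarrow> real^4^'n \<Rightarrow> real"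
  where "pairing q t D D' = lmul (t v* q) D \<bullet> D'"

definition cubic :: "real^3^3^3 \<Rightarrow> real^3 \<Rightarrow> real^3 \<Rightarrow> real^3 \<Rightarrow> real"
  where "cubic c u v w = (\<Sum>i\<in>UNIV. \<Sum>j\<in>UNIV. \<Sum>k\<in>UNIV. c $ i $ j $ k * (u $ i * v $ j * w $ k))"

lemma lmul_simps:
  "lmul (q + q') D = lmul q D + lmul q' D" "lmul q (D + D') = lmul q D + lmul q D'"
  "lmul (c *\<^sub>R q) D = c *\<^sub>R lmul q D" "lmul q (c *\<^sub>R D) = c *\<^sub>R lmul q D"
  "lmul 0 D = 0" "lmul q 0 = 0" "lmul (- q) D = - lmul q D"
  by (simp_all add: bilinear_ladd[OF bilinear_left_mult] bilinear_radd[OF bilinear_left_mult]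
      bilinear_lmul[OF bilinear_left_mult] bilinear_rmul[OF bilinear_left_mult]
      bilinear_lzero[OF bilinear_left_mult] bilinear_rzero[OF bilinear_left_mult]
      bilinear_lneg[OF bilinear_left_mult])

lemma lmul_sum_left: "lmul (\<Sum>i\<in>A. q i) D = (\<Sum>i\<in>A. lmul (q i) D)"
  using linear_sum[of "\<lambda>q. lmul q D" q A] bilinear_left_mult unfolding bilinear_def by blast

lemma pairing_alt: "pairing q t D D' = (\<Sum>i\<in>UNIV. t $ i * (lmul (q $ i) D \<bullet> D'))"
  by (simp add: pairing_def vector_matrix_mult_rows lmul_sum_left lmul_simps inner_sum_left)

lemma pairing_simps:
  "pairing (q + q') t D D' = pairing q t D D' + pairing q' t D D'"
  "pairing (c *\<^sub>R q) t D D' = c * pairing q t D D'"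
  "pairing q (t + t') D D' = pairing q t D D' + pairing q t' D D'"
  "pairing q (c *\<^sub>R t) D D' = c * pairing q t D D'"
  "pairing q t (D + D1) D' = pairing q t D D' + pairing q t D1 D'"
  "pairing q t (c *\<^sub>R D) D' = c * pairing q t D D'"
  "pairing q t D (D' + D1) = pairing q t D D' + pairing q t D D1"
  "pairing q t D (c *\<^sub>R D') = c * pairing q t D D'"
  "pairing q 0 D D' = 0" "pairing q t 0 D' = 0" "pairing q t D 0 = 0"
  by (simp_all add: pairing_alt lmul_simps inner_add_left inner_add_right algebra_simps
      sum.distrib sum_distrib_left)

lemma cubic_simps:
  "cubic (c + c') u v w = cubic c u v w + cubic c' u v w"
  "cubic (r *\<^sub>R c) u v w = r * cubic c u v w"
  "cubic c (u + u') v w = cubic c u v w + cubic c u' v w"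
  "cubic c u (v + v') w = cubic c u v w + cubic c u v' w"
  "cubic c u v (w + w') = cubic c u v w + cubic c u v w'"
  "cubic c (r *\<^sub>R u) v w = r * cubic c u v w"
  "cubic c u (r *\<^sub>R v) w = r * cubic c u v w"
  "cubic c u v (r *\<^sub>R w) = r * cubic c u v w"
  "cubic c 0 v w = 0" "cubic c u 0 w = 0" "cubic c u v 0 = 0"
  by (simp_all add: cubic_def algebra_simps sum.distrib sum_distrib_left)

lemma cubic_axis: "cubic c (axis i 1) (axis j 1) (axis k 1) = c $ i $ j $ k"
  using exhaust_3[of i] exhaust_3[of j] exhaust_3[of k]
  by (auto simp: cubic_def sum_3 axis_def)

lemma trilinear_eq_cubic:
  fixes f :: "real^3 \<Rightarrow> real^3 \<Rightarrow> real^3 \<Rightarrow> real"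
  assumes "trilinear f"
  shows "f u v w = cubic (\<chi> i j k. f (axis i 1) (axis j 1) (axis k 1)) u v w"
proof -
  have e: "x = (\<Sum>i\<in>UNIV. x $ i *\<^sub>R axis i 1)" for x :: "real^3"
    using basis_expansion[of x] by (simp add: scalar_mult_eq_scaleR)
  have "f u v w = f (\<Sum>i\<in>UNIV. u $ i *\<^sub>R axis i 1) (\<Sum>i\<in>UNIV. v $ i *\<^sub>R axis i 1) (\<Sum>i\<in>UNIV. w $ i *\<^sub>R axis i 1)"
    by (simp only: e[symmetric])
  also have "\<dots> = cubic (\<chi> i j k. f (axis i 1) (axis j 1) (axis k 1)) u v w"
    unfolding trilinear_simps[OF assms] cubic_def
    by (simp add: sum_3 algebra_simps)
  finally show ?thesis .
qed

lemma pairing_eq_0D: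
  assumes "\<And>t (D :: real^4^'n::finite) D'. pairing q t D D' = 0"
  shows "q = 0"
proof -
  have "pairing q (axis i 1) D D' = lmul (q $ i) D \<bullet> D'" for i and D D' :: "real^4^'n"
    by (simp add: pairing_alt axis_def if_distrib[of "\<lambda>c. c * _"] cong: if_cong)
  then have "q $ i = 0" for i
    using assms lmul_form_eq_0D[where 'n = 'n] by metis
  then show ?thesis by (simp add: vec_eq_iff)
qed

lemma pairing_invariant:
  assumes "B \<in> so" "p \<in> imaginary"
  shows "pairing q t (hact B p D) D' + pairing q t D (hact B p D') = 0"
  by (simp add: pairing_def hact_lmul[symmetric] hact_skew[OF assms])

text \<open>
  The quaternions that describe a form on \<open>W \<times> W \<times> T\<close>, \<open>W \<times> T \<times> W\<close> and \<open>T \<times> W \<times> W\<close>, for each of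
  the three basis vectors of \<open>T\<close>, and the coefficients of the form on \<open>T \<times> T \<times> T\<close>.
\<close>

type_synonym form_params = "(real^4^3) \<times> (real^4^3) \<times> (real^4^3) \<times> (real^3^3^3)"

definition form_of :: "form_params \<Rightarrow> 'n::finite mspace \<Rightarrow> 'n mspace \<Rightarrow> 'n mspace \<Rightarrow> real"
  where "form_of P x y z =
      pairing (fst P) (tpart z) (wpart x) (wpart y)
    + pairing (fst (snd P)) (tpart y) (wpart x) (wpart z)
    + pairing (fst (snd (snd P))) (tpart x) (wpart y) (wpart z)
    + cubic (snd (snd (snd P))) (tpart x) (tpart y) (tpart z)"

lemma linear_form_of: "linear form_of"
  by (intro linearI ext) (simp_all add: form_of_def pairing_simps cubic_simps algebra_simps)

lemma inj_form_of: "inj (form_of :: _ \<Rightarrow> 'n::finite mspace \<Rightarrow> _)"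
proof (rule linear_injective_0[OF linear_form_of, THEN iffD2], intro allI impI)
  fix P :: form_params
  assume "form_of P = (0 :: 'n mspace \<Rightarrow> _)"
  then have 0: "form_of P x y z = 0" for x y z :: "'n mspace"
    by simp
  have "pairing (fst P) t D D' = 0" for t and D D' :: "real^4^'n"
    using 0[of "mk D 0" "mk D' 0" "mk 0 t"] by (simp add: form_of_def pairing_simps cubic_simps)
  moreover have "pairing (fst (snd P)) t D D' = 0" for t and D D' :: "real^4^'n"
    using 0[of "mk D 0" "mk 0 t" "mk D' 0"] by (simp add: form_of_def pairing_simps cubic_simps)
  moreover have "pairing (fst (snd (snd P))) t D D' = 0" for t and D D' :: "real^4^'n"
    using 0[of "mk 0 t" "mk D 0" "mk D' 0"] by (simp add: form_of_def pairing_simps cubic_simps)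
  moreover have "cubic (snd (snd (snd P))) u v w = 0" for u v w
    using 0[of "mk 0 u" "mk 0 v" "mk 0 w"] by (simp add: form_of_def pairing_simps)
  then have "snd (snd (snd P)) = 0"
    unfolding vec_eq_iff using cubic_axis by (metis zero_index)
  ultimately show "P = 0"
    by (simp add: prod_eq_iff pairing_eq_0D[where 'n = 'n])
qed

lemma invariant_form_of: "invariant_form (form_of P :: 'n::finite mspace \<Rightarrow> _)"
proof -
  have "trilinear (form_of P :: 'n mspace \<Rightarrow> _)"
    unfolding trilinear_def
    by (auto intro!: linearI simp: form_of_def pairing_simps cubic_simps algebra_simps)
  moreover have "form_of P (mk (hact B p (wpart x)) 0) y z + form_of P x (mk (hact B p (wpart y)) 0) z
      + form_of P x y (mk (hact B p (wpart z)) 0) = 0"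
    if "B \<in> so" "p \<in> imaginary" for B p and x y z :: "'n mspace"
    using pairing_invariant[OF that, of "fst P" "tpart z" "wpart x" "wpart y"]
      pairing_invariant[OF that, of "fst (snd P)" "tpart y" "wpart x" "wpart z"]
      pairing_invariant[OF that, of "fst (snd (snd P))" "tpart x" "wpart y" "wpart z"]
    by (simp add: form_of_def pairing_simps cubic_simps)
  ultimately show ?thesis by (simp add: invariant_form_iff)
qed

text \<open>
  For a fixed third argument in \<open>T\<close>, on which \<open>\<hh>\<close> acts by zero, the form is an invariant bilinear form on
  \<open>W\<close>; by linearity in that argument it suffices to know the quaternions that
  belong to a basis of \<open>T\<close>.
\<close>

lemma invariant_form_WWT:
  fixes \<tau> :: "'n::finite mspace \<Rightarrow> 'n mspace \<Rightarrow> 'n mspace \<Rightarrow> real"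
  assumes n: "CARD('n) \<ge> 3" and \<tau>: "invariant_form \<tau>"
  obtains q where "\<And>t D D'. \<tau> (mk D 0) (mk D' 0) (mk 0 t) = pairing q t D D'"
proof -
  have tri: "trilinear \<tau>" and inv: "\<And>B p x y z. B \<in> so \<Longrightarrow> p \<in> imaginary \<Longrightarrow>
    \<tau> (mk (hact B p (wpart x)) 0) y z + \<tau> x (mk (hact B p (wpart y)) 0) z
      + \<tau> x y (mk (hact B p (wpart z)) 0) = 0"
    using \<tau> unfolding invariant_form_iff by blast+
  have ex: "\<exists>q. \<forall>D D'. \<tau> (mk D 0) (mk D' 0) (mk 0 t) = lmul q D \<bullet> D'" for t
  proof (rule invariant_bilinear_form[OF n])
    have s: "mk (D + D') 0 = mk D 0 + mk D' 0" "mk (c *\<^sub>R D) 0 = c *\<^sub>R mk D 0" for D D' :: "real^4^'n" and c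
      by (simp_all add: mk_add mk_scale)
    show "bilinear (\<lambda>D D'. \<tau> (mk D 0) (mk D' 0) (mk 0 t))"
      unfolding bilinear_def by (auto intro!: linearI simp: s trilinear_simps[OF tri])
  next
    fix B :: "real^'n^'n" and p D D'
    assume "B \<in> so" "p \<in> imaginary"
    from inv[OF this, of "mk D 0" "mk D' 0" "mk 0 t"]
    show "\<tau> (mk (hact B p D) 0) (mk D' 0) (mk 0 t) + \<tau> (mk D 0) (mk (hact B p D') 0) (mk 0 t) = 0"
      by (simp add: trilinear_simps[OF tri])
  qed
  have "\<forall>i. \<exists>q. \<forall>D D'. \<tau> (mk D 0) (mk D' 0) (mk 0 (axis i 1)) = lmul q D \<bullet> D'"
    using ex by blast
  then obtain q where q: "\<And>i D D'. \<tau> (mk D 0) (mk D' 0) (mk 0 (axis i 1)) = lmul (q i) D \<bullet> D'"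
    by metis
  have "\<tau> (mk D 0) (mk D' 0) (mk 0 t) = pairing (\<chi> i. q i) t D D'" for t D D'
  proof -
    have "mk 0 t = (\<Sum>i\<in>UNIV. t $ i *\<^sub>R mk 0 (axis i 1))"
    proof -
      have "(\<Sum>i\<in>UNIV. t $ i *\<^sub>R axis i 1) = t"
        using basis_expansion[of t] by (simp add: scalar_mult_eq_scaleR)
      then show ?thesis
        by (simp add: mspace_eq_iff linear_sum[OF linear_wpart] linear_sum[OF linear_tpart])
    qed
    then have "\<tau> (mk D 0) (mk D' 0) (mk 0 t) = \<tau> (mk D 0) (mk D' 0) (\<Sum>i\<in>UNIV. t $ i *\<^sub>R mk 0 (axis i 1))"
      by (rule arg_cong)
    then show ?thesis by (simp add: trilinear_simps[OF tri] q pairing_alt)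
  qed
  then show ?thesis using that by blast
qed

text \<open>
  An invariant linear form on \<open>W\<close> vanishes on the image of the complex structure, which is all of \<open>W\<close>.
\<close>

lemma invariant_form_WTT_eq_0:
  assumes \<tau>: "invariant_form \<tau>"
  shows "\<tau> (mk D 0) (mk 0 t) (mk 0 u) = 0"
proof -
  have 2: "axis 2 1 \<in> imaginary" by (simp add: imaginary_def axis_def)
  have 0: "0 \<in> (so :: (real^'a^'a) set)" by (simp add: so_def transpose_0_mat)
  have tri: "trilinear \<tau>" using \<tau> by (simp add: invariant_form_def)
  \<comment> \<open>\<open>axis 2 1\<close> is the quaternion \<open>i\<close>, whose square is \<open>- 1\<close>.\<close>
  let ?J = "hact 0 (axis 2 1) :: real^4^'a \<Rightarrow> real^4^'a"
  have "\<tau> (mk (?J x) 0) (mk 0 t) (mk 0 u) = 0" for x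
    using \<tau>[unfolded invariant_form_iff, THEN conjunct2, rule_format, OF 0 2, of "mk x 0" "mk 0 t" "mk 0 u"]
    by (simp add: trilinear_simps[OF tri])
  moreover have "?J (- ?J D) = D"
    by (simp add: hact_def rmul_def vec_eq_iff matrix_matrix_mult_def forall_4 qmult_def axis_def)
  ultimately show ?thesis by metis
qed

lemma invariant_form_WWW_eq_0:
  assumes \<tau>: "invariant_form \<tau>"
  shows "\<tau> (mk D 0) (mk D' 0) (mk D'' 0) = 0"
proof -
  have 2: "axis 2 1 \<in> imaginary" by (simp add: imaginary_def axis_def)
  have 0: "0 \<in> (so :: (real^'a^'a) set)" by (simp add: so_def transpose_0_mat)
  have tri: "trilinear \<tau>" using \<tau> by (simp add: invariant_form_def)
  let ?J = "hact 0 (axis 2 1) :: real^4^'a \<Rightarrow> real^4^'a"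
  have s: "mk (D + D') 0 = mk D 0 + mk D' 0" "mk (c *\<^sub>R D) 0 = c *\<^sub>R mk D 0" for D D' :: "real^4^'a" and c
    by (simp_all add: mk_add mk_scale)
  show ?thesis
  proof (rule complex_structure_invariant_trilinear_eq_0[where J = ?J])
    show "trilinear (\<lambda>D D' D''. \<tau> (mk D 0) (mk D' 0) (mk D'' 0))"
      unfolding trilinear_def by (auto intro!: linearI simp: s trilinear_simps[OF tri])
    show "?J (?J x) = - x" for x
      by (simp add: hact_def rmul_def vec_eq_iff matrix_matrix_mult_def forall_4 qmult_def axis_def)
    show "\<tau> (mk (?J x) 0) (mk y 0) (mk z 0) + \<tau> (mk x 0) (mk (?J y) 0) (mk z 0)
        + \<tau> (mk x 0) (mk y 0) (mk (?J z) 0) = 0" for x y z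
      using \<tau>[unfolded invariant_form_iff, THEN conjunct2, rule_format, OF 0 2, of "mk x 0" "mk y 0" "mk z 0"]
      by simp
  qed
qed

text \<open>
  Split each argument into its two components and expand. Of the eight terms, those with one or three
  arguments in \<open>W\<close> vanish.
\<close>

theorem invariant_form_classification:
  fixes \<tau> :: "'n::finite mspace \<Rightarrow> 'n mspace \<Rightarrow> 'n mspace \<Rightarrow> real"
  assumes n: "CARD('n) \<ge> 3" and \<tau>: "invariant_form \<tau>"
  shows "\<tau> \<in> range form_of"
proof -
  have tri: "trilinear \<tau>" using \<tau> by (simp add: invariant_form_def)
  note p = invariant_form_permute[OF \<tau>]
  obtain q1 where q1: "\<And>t D D'. \<tau> (mk D 0) (mk D' 0) (mk 0 t) = pairing q1 t D D'"
    using invariant_form_WWT[OF n \<tau>] by metis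
  obtain q2 where q2: "\<And>t D D'. \<tau> (mk D 0) (mk 0 t) (mk D' 0) = pairing q2 t D D'"
    using invariant_form_WWT[OF n p(1)] by metis
  obtain q3 where q3: "\<And>t D D'. \<tau> (mk 0 t) (mk D 0) (mk D' 0) = pairing q3 t D D'"
    using invariant_form_WWT[OF n p(3)] by metis
  have "trilinear (\<lambda>t u v. \<tau> (mk 0 t) (mk 0 u) (mk 0 v))"
  proof -
    have s: "mk 0 (t + u) = mk 0 t + mk 0 u" "mk 0 (c *\<^sub>R t) = c *\<^sub>R mk 0 t" for t u and c
      by (simp_all add: mk_add mk_scale)
    show ?thesis
      unfolding trilinear_def by (auto intro!: linearI simp: s trilinear_simps[OF tri])
  qed
  from trilinear_eq_cubic[OF this] obtain c where
    c: "\<And>t u v. \<tau> (mk 0 t) (mk 0 u) (mk 0 v) = cubic c t u v" by blast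
  have "\<tau> x y z = form_of (q1, q2, q3, c) x y z" for x y z
  proof -
    have d: "x = mk (wpart x) 0 + mk 0 (tpart x)" for x :: "'n mspace"
      by (simp add: mspace_eq_iff)
    have "\<tau> x y z = \<tau> (mk (wpart x) 0 + mk 0 (tpart x)) (mk (wpart y) 0 + mk 0 (tpart y)) (mk (wpart z) 0 + mk 0 (tpart z))"
      by (simp only: d[symmetric])
    also have "\<dots> = form_of (q1, q2, q3, c) x y z"
      using invariant_form_WTT_eq_0[OF \<tau>] invariant_form_WTT_eq_0[OF p(2)] invariant_form_WTT_eq_0[OF invariant_form_permute(3)[OF p(3)]]
      by (simp add: trilinear_simps[OF tri] q1 q2 q3 c form_of_def invariant_form_WWW_eq_0[OF \<tau>])
    finally show ?thesis .
  qed
  then have "\<tau> = form_of (q1, q2, q3, c)" by (intro ext)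
  then show ?thesis by blast
qed

section \<open>Skew and alternating invariant forms\<close>

definition cqs :: "real^4^3 \<Rightarrow> real^4^3"
  where "cqs q = (\<chi> i. qconj (q $ i))"

lemma qconj_nth [simp]: "qconj q $ 1 = q $ 1" "qconj q $ 2 = - q $ 2" "qconj q $ 3 = - q $ 3" "qconj q $ 4 = - q $ 4"
  by (simp_all add: qconj_def)

lemma pairing_commute: "pairing q t D D' = pairing (cqs q) t D' D"
  by (simp add: pairing_alt cqs_def lmul_adjoint inner_commute[of D])

text \<open>
  The action on parameters of exchanging two arguments of a form. The pairing of two arguments in \<open>W\<close> in
  the opposite order is the pairing with the conjugate quaternions, since the adjoint of left multiplication by
  \<open>q\<close> is left multiplication by the conjugate of \<open>q\<close>.
\<close>

definition swap23 :: "form_params \<Rightarrow> form_params"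
  where "swap23 = (\<lambda>(q1, q2, q3, c). (q2, q1, cqs q3, \<chi> i j k. c $ i $ k $ j))"

definition swap12 :: "form_params \<Rightarrow> form_params"
  where "swap12 = (\<lambda>(q1, q2, q3, c). (cqs q1, q3, q2, \<chi> i j k. c $ j $ i $ k))"

lemma form_of_swap23: "form_of P x z y = form_of (swap23 P) x y z"
  by (cases P) (simp add: form_of_def swap23_def pairing_commute[of _ _ "wpart z" "wpart y"]
      cubic_def sum_3 algebra_simps)

lemma form_of_swap12: "form_of P y x z = form_of (swap12 P) x y z"
  by (cases P) (simp add: form_of_def swap12_def pairing_commute[of _ _ "wpart y" "wpart x"]
      cubic_def sum_3 algebra_simps)

text \<open>
  Parameters are determined by the form, so symmetry conditions on forms are equations
  between parameters.
\<close>

lemma form_of_skew_iff: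
  "(\<forall>x y z :: 'n::finite mspace. form_of P' x y z = - form_of P x y z) \<longleftrightarrow> P' = - P"
proof -
  have "form_of (- P) x y z = - form_of P x y z" for x y z :: "'n mspace"
    by (simp add: linear_neg[OF linear_form_of])
  then have "(\<forall>x y z :: 'n mspace. form_of P' x y z = - form_of P x y z)
      \<longleftrightarrow> (form_of P' :: 'n mspace \<Rightarrow> _) = form_of (- P)"
    by (simp add: fun_eq_iff)
  also have "\<dots> \<longleftrightarrow> P' = - P"
    by (rule inj_eq[OF inj_form_of])
  finally show ?thesis .
qed

lemma form_of_skew23_iff:
  "(\<forall>x y z :: 'n::finite mspace. form_of P x z y = - form_of P x y z) \<longleftrightarrow> swap23 P = - P"
  unfolding form_of_skew_iff[where 'n = 'n, symmetric] by (simp only: form_of_swap23[symmetric])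

lemma form_of_skew12_iff:
  "(\<forall>x y z :: 'n::finite mspace. form_of P y x z = - form_of P x y z) \<longleftrightarrow> swap12 P = - P"
  unfolding form_of_skew_iff[where 'n = 'n, symmetric] by (simp only: form_of_swap12[symmetric])

text \<open>
  The matrix of the bilinear form \<open>(x, y) \<mapsto> v \<bullet> (x \<times> y)\<close> on \<open>\<real>\<^sup>3\<close>; every skew form on
  \<open>\<real>\<^sup>3\<close> arises from a unique \<open>v\<close>.
\<close>

definition crossmat :: "real^3 \<Rightarrow> real^3^3"
  where "crossmat v = vector [vector [0, v$3, - v$2], vector [- v$3, 0, v$1], vector [v$2, - v$1, 0]]"

text \<open>
  The solutions of \<open>swap23 P = - P\<close>: the second family of quaternions is minus the first, those of the third
  family are imaginary, and the cubic form is skew in its last two arguments.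
\<close>

definition skew23_params :: "(real^4^3) \<times> (real^3^3) \<times> (real^3^3) \<Rightarrow> form_params"
  where "skew23_params S = (fst S, - fst S, \<chi> i. imq (fst (snd S) $ i), \<chi> i. crossmat (snd (snd S) $ i))"

definition scalar_mat3 :: "real \<Rightarrow> real^3^3"
  where "scalar_mat3 s = vector [vector [s, 0, 0], vector [0, s, 0], vector [0, 0, s]]"

text \<open>
  Skewness in the first two arguments moreover identifies the third family with the first, which thus
  becomes imaginary, and reduces the cubic form to a multiple of the determinant.
\<close>

definition alternating_params :: "(real^3^3) \<times> real \<Rightarrow> form_params"
  where "alternating_params S = skew23_params (\<chi> i. imq (fst S $ i), fst S, scalar_mat3 (snd S))"

lemma linear_skew23_params: "linear skew23_params"
  by (intro linearI) (simp_all add: skew23_params_def vec_eq_iff forall_3 forall_4 crossmat_def algebra_simps)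

lemma inj_skew23_params: "inj skew23_params"
  by (rule linear_injective_0[OF linear_skew23_params, THEN iffD2])
     (auto simp: skew23_params_def vec_eq_iff forall_3 forall_4 crossmat_def zero_prod_def)

lemma linear_alternating_params: "linear alternating_params"
  by (intro linearI) (simp_all add: alternating_params_def skew23_params_def vec_eq_iff forall_3 forall_4 crossmat_def scalar_mat3_def algebra_simps)

lemma inj_alternating_params: "inj alternating_params"
  by (rule linear_injective_0[OF linear_alternating_params, THEN iffD2])
     (auto simp: alternating_params_def skew23_params_def vec_eq_iff forall_3 forall_4 crossmat_def scalar_mat3_def zero_prod_def)

lemma range_skew23_params: "range skew23_params = {P. swap23 P = - P}"
proof (intro equalityI subsetI)
  fix P assume "P \<in> range skew23_params"
  then show "P \<in> {P. swap23 P = - P}"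
    by (auto simp: skew23_params_def swap23_def cqs_def vec_eq_iff forall_3 forall_4 crossmat_def)
next
  fix P assume "P \<in> {P. swap23 P = - P}"
  moreover obtain q1 q2 q3 c where P: "P = (q1, q2, q3, c)" by (rule prod_cases4)
  ultimately have "swap23 (q1, q2, q3, c) = - (q1, q2, q3, c)"
    by blast
  then have "(q2, q1, cqs q3, \<chi> i j k. c $ i $ k $ j) = (- q1, - q2, - q3, - c)"
    unfolding swap23_def prod.case uminus_Pair .
  then have q2: "q2 = - q1" and q3: "cqs q3 = - q3" and c: "(\<chi> i j k. c $ i $ k $ j) = - c"
    unfolding prod.inject by blast+
  have q3: "q3 $ i $ 1 = 0" for i
    using arg_cong[OF q3, of "\<lambda>q. q $ i $ 1"] by (simp add: cqs_def)
  have c: "c $ i $ k $ j = - c $ i $ j $ k" for i j k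
    using arg_cong[OF c, of "\<lambda>c. c $ i $ j $ k"] by simp
  have c0: "c $ i $ j $ j = 0" for i j
    using c[of i j j] by simp
  have "q3 = (\<chi> i. imq ((\<chi> i. vector [q3$i$2, q3$i$3, q3$i$4]) $ i))"
    by (simp add: vec_eq_iff forall_4 q3)
  \<comment> \<open>The skew matrix \<open>c $ i\<close> belongs to the vector of its entries at (2,3), (3,1) and (1,2).\<close>
  moreover have "c $ i $ j $ k = crossmat (vector [c$i$2$3, c$i$3$1, c$i$1$2]) $ j $ k" for i j k
    using exhaust_3[of j] exhaust_3[of k]
    by (auto simp: crossmat_def c0 c[of i 2 3] c[of i 3 1] c[of i 1 2])
  then have "c = (\<chi> i. crossmat ((\<chi> i. vector [c$i$2$3, c$i$3$1, c$i$1$2]) $ i))"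
    unfolding vec_eq_iff vec_lambda_beta by blast
  ultimately have "P = skew23_params (q1, \<chi> i. vector [q3$i$2, q3$i$3, q3$i$4],
      \<chi> i. vector [c$i$2$3, c$i$3$1, c$i$1$2])"
    unfolding skew23_params_def P fst_conv snd_conv q2 prod.inject by blast
  then show "P \<in> range skew23_params" by (rule range_eqI)
qed

lemma crossmat_mat_swap: "crossmat (scalar_mat3 s $ j) $ i $ k = - crossmat (scalar_mat3 s $ i) $ j $ k"
  using exhaust_3[of i] exhaust_3[of j] exhaust_3[of k]
  by (auto simp: crossmat_def scalar_mat3_def)

text \<open>
  By \<open>range_skew23_params\<close>, only parameters from \<open>skew23_params\<close> matter. For these, skewness under \<open>swap12\<close> equates the
  first and third families and makes the matrix \<open>m\<close> of the cubic part satisfy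
  \<open>m\<^sub>j \<bullet> (e\<^sub>i \<times> e\<^sub>k) = - m\<^sub>i \<bullet> (e\<^sub>j \<times> e\<^sub>k)\<close>, whose solutions are the scalar matrices.
\<close>

lemma range_alternating_params: "range alternating_params = {P. swap23 P = - P \<and> swap12 P = - P}"
proof (intro equalityI subsetI)
  fix P assume "P \<in> range alternating_params"
  then obtain r s where P: "P = alternating_params (r, s)" by auto
  have "swap23 P = - P"
    using range_skew23_params unfolding P alternating_params_def by blast
  moreover have "cqs (\<chi> i. imq (r $ i)) = - (\<chi> i. imq (r $ i))"
    by (simp add: cqs_def vec_eq_iff forall_4)
  moreover have "(\<chi> i j k. crossmat (scalar_mat3 s $ j) $ i $ k) = - (\<chi> i. crossmat (scalar_mat3 s $ i))"
    by (simp add: vec_eq_iff crossmat_mat_swap[symmetric])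
  ultimately show "P \<in> {P. swap23 P = - P \<and> swap12 P = - P}"
    by (simp add: P alternating_params_def skew23_params_def swap12_def)
next
  fix P assume P: "P \<in> {P. swap23 P = - P \<and> swap12 P = - P}"
  then have "P \<in> range skew23_params" by (simp add: range_skew23_params)
  then obtain q r m where S: "P = skew23_params (q, r, m)" by auto
  have "swap12 P = - P" using P by simp
  then have q: "(\<chi> i. imq (r $ i)) = q"
    and c: "(\<chi> i j k. crossmat (m $ j) $ i $ k) = - (\<chi> i. crossmat (m $ i))"
    unfolding S skew23_params_def swap12_def prod.case uminus_Pair fst_conv snd_conv prod.inject neg_equal_iff_equal minus_minus vec_lambda_beta
    by blast+
  have c: "crossmat (m $ j) $ i $ k = - crossmat (m $ i) $ j $ k" for i j k
    using arg_cong[OF c, of "\<lambda>c. c $ i $ j $ k"] by simp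
  have "m $ 1 $ 2 = 0" "m $ 1 $ 3 = 0" "m $ 2 $ 1 = 0" "m $ 2 $ 3 = 0" "m $ 3 $ 1 = 0" "m $ 3 $ 2 = 0"
    "m $ 2 $ 2 = m $ 1 $ 1" "m $ 3 $ 3 = m $ 1 $ 1"
    using c[of 1 1 3] c[of 1 1 2] c[of 2 2 3] c[of 2 2 1] c[of 3 3 2] c[of 3 3 1] c[of 1 2 3] c[of 1 3 2]
    unfolding crossmat_def vector_3 by linarith+
  then have "m $ i $ j = scalar_mat3 (m $ 1 $ 1) $ i $ j" for i j
    using exhaust_3[of i] exhaust_3[of j] by (auto simp: scalar_mat3_def)
  then have "m = scalar_mat3 (m $ 1 $ 1)"
    unfolding vec_eq_iff by blast
  then have "P = alternating_params (r, m $ 1 $ 1)"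
    by (simp add: S alternating_params_def q)
  then show "P \<in> range alternating_params" by (rule range_eqI)
qed

section \<open>The invariant inner product\<close>

text \<open>
  Up to scaling on the two summands this is the negative of the trace form of \<open>so(n + 4)\<close>, which explains its
  invariance under the bracket (lemma \<open>ad_skew\<close> below).
\<close>

definition ip :: "'n::finite mspace \<Rightarrow> 'n mspace \<Rightarrow> real"
  where "ip x y = wpart x \<bullet> wpart y + tpart x \<bullet> tpart y"

lemma ip_simps [simp]:
  "ip (x + x') y = ip x y + ip x' y" "ip x (y + y') = ip x y + ip x y'"
  "ip (c *\<^sub>R x) y = c * ip x y" "ip x (c *\<^sub>R y) = c * ip x y" "ip 0 y = 0" "ip x 0 = 0"
  by (simp_all add: ip_def inner_add_left inner_add_right algebra_simps)

lemma linear_ip: "linear (ip x)" "linear (\<lambda>x. ip x y)"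
  by (auto intro: linearI)

lemma ip_commute: "ip x y = ip y x"
  by (simp add: ip_def inner_commute)

lemma ip_eqI:
  assumes "\<And>z. ip x z = ip y z"
  shows "x = y"
proof -
  have "wpart x = wpart y"
    using assms[of "mk _ 0"] by (intro vector_eq_rdot[THEN iffD1]) (simp add: ip_def)
  moreover have "tpart x = tpart y"
    using assms[of "mk 0 _"] by (intro vector_eq_rdot[THEN iffD1]) (simp add: ip_def)
  ultimately show ?thesis by (simp add: mspace_eq_iff)
qed

lemma ad_skew:
  assumes "X \<in> h_alg"
  shows "ip (ad X x) y = - ip x (ad X y)"
proof -
  obtain B p where "X = block B 0 0 (Rmat p)" and *: "B \<in> so" "p \<in> imaginary"
    using assms by (rule h_algE)
  then show ?thesis
    by (simp add: ad_eq[OF *] ip_def hact_skew[OF *])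
qed

text \<open>
  An orthonormal basis of \<open>\<mm>\<close> with respect to \<open>ip\<close>.
\<close>

definition mbasis :: "'n::finite mspace set"
  where "mbasis = (\<lambda>b. mk (fst b) (snd b)) ` Basis"

lemma mspace_expansion: "(\<Sum>e\<in>mbasis. ip x e *\<^sub>R e) = x"
proof -
  have inj: "inj_on (\<lambda>b. mk (fst b) (snd b)) B" for B :: "((real^4^'a) \<times> (real^3)) set"
    by (auto intro!: inj_onI simp: mspace_eq_iff prod_eq_iff)
  let ?x = "(wpart x, tpart x)"
  have "(\<Sum>e\<in>mbasis. ip x e *\<^sub>R e) = (\<Sum>b\<in>Basis. (?x \<bullet> b) *\<^sub>R mk (fst b) (snd b))"
    unfolding mbasis_def by (simp add: sum.reindex[OF inj] ip_def inner_prod_def)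
  moreover have "wpart (\<Sum>b\<in>Basis. (?x \<bullet> b) *\<^sub>R mk (fst b) (snd b)) = wpart x"
    using arg_cong[OF euclidean_representation[of ?x], of fst]
    by (simp add: linear_sum[OF linear_wpart] fst_sum)
  moreover have "tpart (\<Sum>b\<in>Basis. (?x \<bullet> b) *\<^sub>R mk (fst b) (snd b)) = tpart x"
    using arg_cong[OF euclidean_representation[of ?x], of snd]
    by (simp add: linear_sum[OF linear_tpart] snd_sum)
  ultimately show ?thesis by (simp add: mspace_eq_iff)
qed

text \<open>
  The form in which the orthonormal basis is used: no coordinates occur, and applied to linear forms it is
  the Riesz representation.
\<close>

lemma linear_expansion:
  assumes "linear f"
  shows "(\<Sum>e\<in>mbasis. ip x e *\<^sub>R f e) = f x"
proof -
  have "(\<Sum>e\<in>mbasis. ip x e *\<^sub>R f e) = f (\<Sum>e\<in>mbasis. ip x e *\<^sub>R e)"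
    by (simp add: linear_sum[OF assms] linear_scale[OF assms])
  then show ?thesis by (simp only: mspace_expansion)
qed

lemma tensor_eqI:
  assumes "linear F" "linear G" "\<And>x y. F (tens x y) = G (tens x y)"
  shows "F = G"
proof
  fix t show "F t = G t"
    by (rule linear_eq_on[OF assms(1,2), of _ "range (\<lambda>(x, y). tens x y)"])
      (use assms(3) in \<open>auto simp: span_tens\<close>)
qed

lemma ext_eqI:
  assumes "linear F" "linear G" "\<And>v. F (wedge v) = G (wedge v)"
  shows "F = G"
proof
  fix t show "F t = G t"
    by (rule linear_eq_on[OF assms(1,2), of _ "range wedge"])
      (use assms(3) in \<open>auto simp: span_wedge\<close>)
qed

section \<open>Homomorphisms from the tensor square\<close>

abbreviation Hom_tensor :: "(('n::finite mspace, 'n mspace) tensor \<Rightarrow> 'n mspace) set"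
  where "Hom_tensor \<equiv> Hom_mod h_alg (tensor_action ad ad) ad"

definition tensor_form :: "(('n::finite mspace, 'n mspace) tensor \<Rightarrow> 'n mspace) \<Rightarrow> 'n mspace \<Rightarrow> 'n mspace \<Rightarrow> 'n mspace \<Rightarrow> real"
  where "tensor_form F x y z = ip (F (tens x y)) z"

lemma linear_tensor_form: "linear tensor_form"
  by (intro linearI ext) (simp_all add: tensor_form_def)

lemma Hom_mod_tensor_iff:
  assumes "linear F"
  shows "F \<in> Hom_tensor \<longleftrightarrow>
    (\<forall>X\<in>h_alg. \<forall>x y. F (tens (ad X x) y) + F (tens x (ad X y)) = ad X (F (tens x y)))"
proof -
  have "(\<forall>v. F (tensor_action ad ad X v) = ad X (F v)) \<longleftrightarrow>
    (\<forall>x y. F (tens (ad X x) y) + F (tens x (ad X y)) = ad X (F (tens x y)))"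
    if X: "X \<in> h_alg" for X
  proof -
    note ad = linear_ad[OF X]
    note act = linear_tensor_action[of ad X ad, OF ad ad] tensor_action_tens[of ad X ad, OF ad ad]
    have *: "F (tens (ad X x) y) + F (tens x (ad X y)) = F (tensor_action ad ad X (tens x y))" for x y
      by (simp add: act linear_add[OF assms])
    show ?thesis
      using tensor_eqI[OF linear_compose[OF act(1) assms] linear_compose[OF assms ad]]
      unfolding * o_def by metis
  qed
  then show ?thesis using assms by (simp add: Hom_mod_def)
qed

lemma inj_on_tensor_form: "inj_on tensor_form Hom_tensor"
proof (rule inj_onI)
  fix F G :: "('a mspace, 'a mspace) tensor \<Rightarrow> 'a mspace"
  assume "F \<in> Hom_tensor" "G \<in> Hom_tensor" and eq: "tensor_form F = tensor_form G"
  then have "linear F" "linear G" by (simp_all add: Hom_mod_def)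
  moreover have "F (tens x y) = G (tens x y)" for x y
    by (rule ip_eqI) (use eq in \<open>simp add: tensor_form_def fun_eq_iff\<close>)
  ultimately show "F = G" by (rule tensor_eqI)
qed

text \<open>
  The bilinear map is recovered from the form as the Riesz representative in the last argument, and
  invariance of the inner product turns equivariance of the map into invariance of the form and back.
\<close>

lemma tensor_form_image: "tensor_form ` Hom_tensor = Collect invariant_form"
proof (intro equalityI subsetI)
  fix \<tau> :: "'a mspace \<Rightarrow> 'a mspace \<Rightarrow> 'a mspace \<Rightarrow> real"
  assume "\<tau> \<in> tensor_form ` Hom_tensor"
  then obtain F where F: "F \<in> Hom_tensor" and \<tau>: "\<tau> = tensor_form F" by blast
  have lin: "linear F" using F by (simp add: Hom_mod_def)
  have "trilinear \<tau>"
    unfolding \<tau> trilinear_def tensor_form_def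
    by (auto intro!: linearI simp: bilinear_ladd[OF bilinear_tens] bilinear_radd[OF bilinear_tens]
        bilinear_lmul[OF bilinear_tens] bilinear_rmul[OF bilinear_tens] linear_add[OF lin] linear_scale[OF lin])
  moreover have "\<tau> (ad X x) y z + \<tau> x (ad X y) z + \<tau> x y (ad X z) = 0" if X: "X \<in> h_alg" for X x y z
  proof -
    have "ip (F (tens (ad X x) y) + F (tens x (ad X y))) z = ip (ad X (F (tens x y))) z"
      using F X by (simp add: Hom_mod_tensor_iff[OF lin])
    then show ?thesis
      by (simp add: \<tau> tensor_form_def ad_skew[OF X])
  qed
  ultimately show "\<tau> \<in> Collect invariant_form" by (simp add: invariant_form_def)
next
  fix \<tau> :: "'a mspace \<Rightarrow> 'a mspace \<Rightarrow> 'a mspace \<Rightarrow> real"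
  assume "\<tau> \<in> Collect invariant_form"
  then have tri: "trilinear \<tau>"
    and inv: "\<And>X x y z. X \<in> h_alg \<Longrightarrow> \<tau> (ad X x) y z + \<tau> x (ad X y) z + \<tau> x y (ad X z) = 0"
    by (simp_all add: invariant_form_def)
  define \<beta> where "\<beta> x y = (\<Sum>e\<in>mbasis. \<tau> x y e *\<^sub>R e)" for x y
  have \<beta>: "ip (\<beta> x y) z = \<tau> x y z" for x y z
    using linear_expansion[OF trilinearD(3)[OF tri], of z x y]
    by (simp add: \<beta>_def ip_commute[of _ z] linear_sum[OF linear_ip(1)] mult.commute)
  have bil: "bilinear \<beta>"
    unfolding bilinear_def
    by (auto intro!: linearI simp: \<beta>_def trilinear_simps[OF tri] scaleR_add_left sum.distrib scaleR_sum_right)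
  note F = linear_tensor_lift[OF bil] tensor_lift_tens[OF bil]
  have hom: "tensor_lift \<beta> \<in> Hom_tensor"
    unfolding Hom_mod_tensor_iff[OF F(1)] F(2)
  proof (intro ballI allI ip_eqI)
    fix X :: "real^('a + 4)^('a + 4)" and x y z
    assume X: "X \<in> h_alg"
    show "ip (\<beta> (ad X x) y + \<beta> x (ad X y)) z = ip (ad X (\<beta> x y)) z"
      using inv[OF X, of x y z] by (simp add: \<beta> ad_skew[OF X])
  qed
  have "\<tau> = tensor_form (tensor_lift \<beta>)"
    by (intro ext) (simp add: tensor_form_def F \<beta>)
  then show "\<tau> \<in> tensor_form ` Hom_tensor" using hom by (rule image_eqI)
qed

lemma dim_Hom_tensor:
  assumes n: "CARD('n::finite) \<ge> 3"
  shows "dim (Hom_tensor :: (('n mspace, 'n mspace) tensor \<Rightarrow> _) set) = 63"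
proof -
  have "Collect invariant_form = range (form_of :: _ \<Rightarrow> 'n mspace \<Rightarrow> _)"
    using invariant_form_classification[OF n] invariant_form_of by blast
  then have "tensor_form ` (Hom_tensor :: (('n mspace, 'n mspace) tensor \<Rightarrow> _) set) = range form_of"
    by (simp only: tensor_form_image)
  from dim_eq_DIM_if_same_image[OF linear_tensor_form inj_on_tensor_form
      subspace_Hom_mod[OF linear_ad] linear_form_of inj_form_of this]
  show ?thesis by simp
qed

section \<open>Homomorphisms to the second exterior power\<close>

definition vec2 :: "'a \<Rightarrow> 'a \<Rightarrow> 2 \<Rightarrow> 'a"
  where "vec2 x y i = (if i = 1 then x else y)"

lemma vec2_simps [simp]:
  "vec2 x y 1 = x" "vec2 x y 2 = y"
  "(vec2 x y)(1 := z) = vec2 z y" "(vec2 x y)(2 := z) = vec2 x z"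
proof -
  have all: "(\<And>i. f i = g i) \<Longrightarrow> f = g" for f g :: "2 \<Rightarrow> 'a" by blast
  have neq: "(2::2) \<noteq> 1" by simp
  show "vec2 x y 1 = x" "vec2 x y 2 = y" using neq by (simp_all add: vec2_def)
  show "(vec2 x y)(1 := z) = vec2 z y" "(vec2 x y)(2 := z) = vec2 x z"
    using neq by (auto simp: fun_eq_iff vec2_def forall_2)
qed

lemma vec2_eta: "vec2 (v 1) (v 2) = v"
  by (simp add: fun_eq_iff forall_2)

lemma bilinear_wedge2: "bilinear (\<lambda>x y. wedge (vec2 x y))"
  unfolding bilinear_def
proof (intro conjI allI)
  show "linear (\<lambda>y. wedge (vec2 x y))" for x :: 'a
    using linear_wedge[of "vec2 x x" 2] by simp
  show "linear (\<lambda>x. wedge (vec2 x y))" for y :: 'a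
    using linear_wedge[of "vec2 y y" 1] by simp
qed

lemma wedge2_swap: "wedge (vec2 y x) = - wedge (vec2 x y)"
  using wedge_swap[of 1 2 "vec2 x x" x y] by (simp add: add_eq_0_iff)

lemma ext_action_wedge2:
  assumes "linear (\<rho> X)"
  shows "ext_action \<rho> X (wedge (vec2 x y)) = wedge (vec2 (\<rho> X x) y) + wedge (vec2 x (\<rho> X y))"
  by (simp add: ext_action_wedge[of \<rho> X, OF assms] sum_2)

text \<open>
  The embedding of \<open>\<Lambda>\<^sup>2\<mm>\<close> into the bilinear forms on \<open>\<mm>\<close> that the inner product induces. It makes elements of the
  exterior power, which is a quotient, accessible through their values.
\<close>

definition detect :: "('n::finite mspace, 2) ext \<Rightarrow> 'n mspace \<Rightarrow> 'n mspace \<Rightarrow> real"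
  where "detect = ext_lift (\<lambda>v y z. ip (v 1) y * ip (v 2) z - ip (v 1) z * ip (v 2) y)"

lemma linear_detect: "linear (detect :: ('n::finite mspace, 2) ext \<Rightarrow> _)"
  and detect_wedge2: "detect (wedge (vec2 a b :: 2 \<Rightarrow> 'n mspace)) y z = ip a y * ip b z - ip a z * ip b y"
proof -
  let ?g = "\<lambda>(v :: 2 \<Rightarrow> 'n mspace) y z. ip (v 1) y * ip (v 2) z - ip (v 1) z * ip (v 2) y"
  have m: "multilinear ?g"
    unfolding multilinear_def
  proof (intro allI)
    fix v :: "2 \<Rightarrow> 'n mspace" and i :: 2
    obtain a b where v: "v = vec2 a b" using vec2_eta by metis
    show "linear (\<lambda>x. ?g (v(i := x)))"
      unfolding v using exhaust_2[of i]
      by (elim disjE) (auto intro!: linearI simp: fun_eq_iff algebra_simps)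
  qed
  have a: "alternating ?g"
    unfolding alternating_def
  proof (intro allI impI)
    fix v :: "2 \<Rightarrow> 'n mspace" and i j :: 2
    assume "i \<noteq> j" "v i = v j"
    then have "v 1 = v 2" using exhaust_2[of i] exhaust_2[of j] by metis
    then show "?g v = 0" by (intro ext) simp
  qed
  show "linear (detect :: ('n mspace, 2) ext \<Rightarrow> _)"
    unfolding detect_def by (rule linear_ext_lift[OF m a])
  show "detect (wedge (vec2 a b)) y z = ip a y * ip b z - ip a z * ip b y"
    unfolding detect_def ext_lift_wedge[OF m a] by simp
qed

lemma ext2_eqI:
  assumes "linear F" "linear G" "\<And>x y. F (wedge (vec2 x y)) = G (wedge (vec2 x y))"
  shows "F = G"
  by (rule ext_eqI[OF assms(1,2)]) (metis assms(3) vec2_eta)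

lemma linear_detect_apply: "linear (\<lambda>w. detect w y z)"
  by (intro linearI) (simp_all add: linear_add[OF linear_detect] linear_scale[OF linear_detect])

lemma detect_simps:
  "detect w (y + y') z = detect w y z + detect w y' z"
  "detect w y (z + z') = detect w y z + detect w y z'"
  "detect w (c *\<^sub>R y) z = c * detect w y z"
  "detect w y (c *\<^sub>R z) = c * detect w y z"
  "detect w z y = - detect w y z"
proof -
  note lin = linear_detect_apply linear_compose_add[OF linear_detect_apply linear_detect_apply]
    linear_compose_neg[OF linear_detect_apply] linear_compose_scale_right[OF linear_detect_apply, of c, unfolded real_scaleR_def]
  show "detect w (y + y') z = detect w y z + detect w y' z"
    by (rule fun_cong[OF ext2_eqI[OF lin(1,2)]]) (simp add: detect_wedge2 algebra_simps)
  show "detect w y (z + z') = detect w y z + detect w y z'"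
    by (rule fun_cong[OF ext2_eqI[OF lin(1,2)]]) (simp add: detect_wedge2 algebra_simps)
  show "detect w (c *\<^sub>R y) z = c * detect w y z"
    by (rule fun_cong[OF ext2_eqI[OF lin(1,4)]]) (simp add: detect_wedge2 algebra_simps)
  show "detect w y (c *\<^sub>R z) = c * detect w y z"
    by (rule fun_cong[OF ext2_eqI[OF lin(1,4)]]) (simp add: detect_wedge2 algebra_simps)
  show "detect w z y = - detect w y z"
    by (rule fun_cong[OF ext2_eqI[OF lin(1,3)]]) (simp add: detect_wedge2 algebra_simps)
qed

lemma detect_ext_action:
  assumes X: "X \<in> h_alg"
  shows "detect (ext_action ad X w) y z = - (detect w (ad X y) z + detect w y (ad X z))"
proof (rule fun_cong[OF ext2_eqI])
  show "linear (\<lambda>w. detect (ext_action ad X w) y z)"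
    using linear_compose[OF linear_ext_action[of ad X, OF linear_ad[OF X]] linear_detect_apply]
    by (simp add: o_def)
  show "linear (\<lambda>w. - (detect w (ad X y) z + detect w y (ad X z)))"
    by (intro linear_compose_neg linear_compose_add linear_detect_apply)
  show "detect (ext_action ad X (wedge (vec2 a b))) y z
      = - (detect (wedge (vec2 a b)) (ad X y) z + detect (wedge (vec2 a b)) y (ad X z))" for a b
    by (simp add: ext_action_wedge2[of ad X, OF linear_ad[OF X]] linear_add[OF linear_detect]
        detect_wedge2 ad_skew[OF X] algebra_simps)
qed

text \<open>
  The inverse of \<open>detect\<close> on skew forms. The factor \<open>1/2\<close> appears because the double sum contains each pair of
  basis vectors in both orders.
\<close>

definition recover :: "('n::finite mspace \<Rightarrow> 'n mspace \<Rightarrow> real) \<Rightarrow> ('n mspace, 2) ext"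
  where "recover s = (1/2) *\<^sub>R (\<Sum>e\<in>mbasis. \<Sum>e'\<in>mbasis. s e e' *\<^sub>R wedge (vec2 e e'))"

lemma linear_recover: "linear recover"
  by (intro linearI) (simp_all add: recover_def scaleR_add_left sum.distrib scaleR_add_right
      scaleR_sum_right mult.left_commute)

lemma bilinear_expansion:
  assumes "bilinear f"
  shows "(\<Sum>e\<in>mbasis. \<Sum>e'\<in>mbasis. (ip x e * ip y e') *\<^sub>R f e e') = f x y"
proof -
  have lin: "linear (f a)" "linear (\<lambda>a. f a b)" for a b
    using assms by (simp_all add: bilinear_def)
  have "(\<Sum>e\<in>mbasis. \<Sum>e'\<in>mbasis. (ip x e * ip y e') *\<^sub>R f e e')
      = (\<Sum>e\<in>mbasis. ip x e *\<^sub>R (\<Sum>e'\<in>mbasis. ip y e' *\<^sub>R f e e'))"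
    by (simp add: scaleR_sum_right)
  also have "\<dots> = (\<Sum>e\<in>mbasis. ip x e *\<^sub>R f e y)"
    by (simp only: linear_expansion[OF lin(1)])
  also have "\<dots> = f x y"
    by (rule linear_expansion[OF lin(2)])
  finally show ?thesis .
qed

lemma recover_detect: "recover (detect w) = w"
proof (rule fun_cong[OF ext2_eqI, of "\<lambda>w. recover (detect w)" "\<lambda>w. w"])
  show "linear (\<lambda>w. recover (detect w))"
    using linear_compose[OF linear_detect linear_recover] by (simp add: o_def)
  show "linear (\<lambda>w :: ('a mspace, 2) ext. w)" by (rule linear_ident)
  fix x y :: "'a mspace"
  have "(\<Sum>e\<in>mbasis. \<Sum>e'\<in>mbasis. (ip x e * ip y e') *\<^sub>R wedge (vec2 e e')) = wedge (vec2 x y)"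
    by (rule bilinear_expansion[OF bilinear_wedge2])
  moreover have "(\<Sum>e\<in>mbasis. \<Sum>e'\<in>mbasis. (ip x e' * ip y e) *\<^sub>R wedge (vec2 e e')) = - wedge (vec2 x y)"
    using bilinear_expansion[OF bilinear_wedge2, of y x] by (simp add: mult.commute wedge2_swap[of y x])
  ultimately have "recover (detect (wedge (vec2 x y))) = (1/2) *\<^sub>R (wedge (vec2 x y) - (- wedge (vec2 x y)))"
    by (simp add: recover_def detect_wedge2 scaleR_diff_left sum_subtractf)
  then show "recover (detect (wedge (vec2 x y))) = wedge (vec2 x y)"
    by (simp flip: scaleR_2)
qed

lemma detect_recover:
  assumes "bilinear s" and skew: "\<And>y z. s z y = - s y z"
  shows "detect (recover s) = s"
proof (intro ext)
  fix y z
  note sums = linear_sum[OF linear_detect_apply[of y z]]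
  have "detect (recover s) y z = (1/2) * (\<Sum>e\<in>mbasis. \<Sum>e'\<in>mbasis.
      s e e' * (ip e y * ip e' z - ip e z * ip e' y))"
    by (simp add: recover_def linear_scale[OF linear_detect_apply[of y z]] sums detect_wedge2)
  also have "\<dots> = (1/2) * ((\<Sum>e\<in>mbasis. \<Sum>e'\<in>mbasis. (ip y e * ip z e') *\<^sub>R s e e')
      - (\<Sum>e\<in>mbasis. \<Sum>e'\<in>mbasis. (ip z e * ip y e') *\<^sub>R s e e'))"
    by (simp add: ip_commute[of _ y] ip_commute[of _ z] right_diff_distrib sum_subtractf mult.commute)
  also have "\<dots> = s y z"
    by (simp only: bilinear_expansion[OF assms(1)]) (simp add: skew[of z y])
  finally show "detect (recover s) y z = s y z" .
qed

lemma invariant_forms_eq_image: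
  fixes C :: "('n::finite mspace \<Rightarrow> 'n mspace \<Rightarrow> 'n mspace \<Rightarrow> real) \<Rightarrow> bool"
  assumes n: "CARD('n) \<ge> 3" and C: "\<And>P. C (form_of P) \<longleftrightarrow> D P"
  shows "{\<tau>. invariant_form \<tau> \<and> C \<tau>} = form_of ` {P. D P}"
proof (intro equalityI subsetI)
  fix \<tau> assume \<tau>: "\<tau> \<in> {\<tau>. invariant_form \<tau> \<and> C \<tau>}"
  then have "\<tau> \<in> range form_of"
    using invariant_form_classification[OF n] by simp
  then obtain P where P: "\<tau> = form_of P" by (rule imageE)
  have "D P" using \<tau> C[of P] by (simp add: P)
  then show "\<tau> \<in> form_of ` {P. D P}" unfolding P by (intro imageI) simp
next
  fix \<tau> :: "'n mspace \<Rightarrow> 'n mspace \<Rightarrow> 'n mspace \<Rightarrow> real"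
  assume "\<tau> \<in> form_of ` {P. D P}"
  then obtain P where "\<tau> = form_of P" "D P" by (rule imageE) simp
  then show "\<tau> \<in> {\<tau>. invariant_form \<tau> \<and> C \<tau>}"
    using invariant_form_of[of P] C[of P] by simp
qed

abbreviation Hom_ext2 :: "('n::finite mspace \<Rightarrow> ('n mspace, 2) ext) set"
  where "Hom_ext2 \<equiv> Hom_mod h_alg ad (ext_action ad)"

definition ext2_form :: "('n::finite mspace \<Rightarrow> ('n mspace, 2) ext) \<Rightarrow> 'n mspace \<Rightarrow> 'n mspace \<Rightarrow> 'n mspace \<Rightarrow> real"
  where "ext2_form F x = detect (F x)"

lemma linear_ext2_form: "linear ext2_form"
  by (intro linearI ext) (simp_all add: ext2_form_def linear_add[OF linear_detect] linear_scale[OF linear_detect])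

lemma inj_ext2_form: "inj ext2_form"
  by (rule injI) (metis ext ext2_form_def recover_detect)

text \<open>
  Since \<open>detect\<close> is an equivariant isomorphism from \<open>\<Lambda>\<^sup>2\<mm>\<close> onto the skew bilinear forms,
  homomorphisms into \<open>\<Lambda>\<^sup>2\<mm>\<close> are the same as invariant forms that are skew in the last two arguments.
\<close>

lemma ext2_form_image:
  "ext2_form ` Hom_ext2 = {\<tau>. invariant_form \<tau> \<and> (\<forall>x y z. \<tau> x z y = - \<tau> x y z)}"
proof (intro equalityI subsetI)
  fix \<tau> :: "'a mspace \<Rightarrow> 'a mspace \<Rightarrow> 'a mspace \<Rightarrow> real"
  assume "\<tau> \<in> ext2_form ` Hom_ext2"
  then obtain F where \<tau>: "\<tau> = ext2_form F" and F: "linear F"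
    "\<And>X x. X \<in> h_alg \<Longrightarrow> F (ad X x) = ext_action ad X (F x)"
    by (auto simp: Hom_mod_def)
  have "trilinear \<tau>"
    unfolding \<tau> trilinear_def ext2_form_def
    by (auto intro!: linearI simp: detect_simps(1-4) linear_add[OF F(1)] linear_scale[OF F(1)]
        linear_add[OF linear_detect] linear_scale[OF linear_detect])
  moreover have "\<tau> (ad X x) y z + \<tau> x (ad X y) z + \<tau> x y (ad X z) = 0" if X: "X \<in> h_alg" for X x y z
    by (simp add: \<tau> ext2_form_def F(2)[OF X] detect_ext_action[OF X])
  moreover have "\<tau> x z y = - \<tau> x y z" for x y z
    unfolding \<tau> ext2_form_def by (rule detect_simps(5))
  ultimately show "\<tau> \<in> {\<tau>. invariant_form \<tau> \<and> (\<forall>x y z. \<tau> x z y = - \<tau> x y z)}"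
    unfolding invariant_form_def by blast
next
  fix \<tau> :: "'a mspace \<Rightarrow> 'a mspace \<Rightarrow> 'a mspace \<Rightarrow> real"
  assume "\<tau> \<in> {\<tau>. invariant_form \<tau> \<and> (\<forall>x y z. \<tau> x z y = - \<tau> x y z)}"
  then have tri: "trilinear \<tau>" and skew: "\<And>x y z. \<tau> x z y = - \<tau> x y z"
    and inv: "\<And>X x y z. X \<in> h_alg \<Longrightarrow> \<tau> (ad X x) y z + \<tau> x (ad X y) z + \<tau> x y (ad X z) = 0"
    unfolding invariant_form_def by blast+
  define F where "F x = recover (\<tau> x)" for x
  have "bilinear (\<tau> x)" for x
    using tri by (simp add: trilinear_def bilinear_def)
  then have F: "detect (F x) = \<tau> x" for x
    unfolding F_def by (rule detect_recover) (rule skew)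
  have "linear \<tau>"
    by (intro linearI ext) (simp_all add: trilinear_simps[OF tri])
  then have "linear F"
    unfolding F_def using linear_compose[OF _ linear_recover, of \<tau>] by (simp add: o_def)
  moreover have "F (ad X x) = ext_action ad X (F x)" if X: "X \<in> h_alg" for X x
  proof -
    have "detect (F (ad X x)) = detect (ext_action ad X (F x))"
    proof (intro ext)
      fix y z
      show "detect (F (ad X x)) y z = detect (ext_action ad X (F x)) y z"
        using inv[OF X, of x y z] by (simp add: F detect_ext_action[OF X])
    qed
    then show ?thesis by (metis recover_detect)
  qed
  ultimately have "F \<in> Hom_ext2" by (simp add: Hom_mod_def)
  moreover have "ext2_form F = \<tau>" by (intro ext) (simp add: ext2_form_def F)
  ultimately show "\<tau> \<in> ext2_form ` Hom_ext2" by blast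
qed

lemma dim_Hom_ext2:
  assumes n: "CARD('n::finite) \<ge> 3"
  shows "dim (Hom_ext2 :: ('n mspace \<Rightarrow> _) set) = 30"
proof -
  have "{\<tau> :: 'n mspace \<Rightarrow> _. invariant_form \<tau> \<and> (\<forall>x y z. \<tau> x z y = - \<tau> x y z)}
      = form_of ` {P. swap23 P = - P}"
    by (rule invariant_forms_eq_image[OF n]) (rule form_of_skew23_iff)
  also have "\<dots> = range (form_of \<circ> skew23_params)"
    by (simp only: image_comp[symmetric] range_skew23_params)
  finally have "ext2_form ` (Hom_ext2 :: ('n mspace \<Rightarrow> _) set) = range (form_of \<circ> skew23_params)"
    by (simp only: ext2_form_image)
  from dim_eq_DIM_if_same_image[OF linear_ext2_form inj_on_subset[OF inj_ext2_form subset_UNIV]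
      subspace_Hom_mod[OF linear_ext_action[OF linear_ad]]
      linear_compose[OF linear_skew23_params linear_form_of]
      inj_compose[OF inj_form_of inj_skew23_params] this]
  show ?thesis by simp
qed

section \<open>Homomorphisms from the third exterior power\<close>

definition vec3 :: "'a \<Rightarrow> 'a \<Rightarrow> 'a \<Rightarrow> 3 \<Rightarrow> 'a"
  where "vec3 x y z i = (if i = 1 then x else if i = 2 then y else z)"

lemma vec3_simps [simp]:
  "vec3 x y z 1 = x" "vec3 x y z 2 = y" "vec3 x y z 3 = z"
  "(vec3 x y z)(1 := u) = vec3 u y z" "(vec3 x y z)(2 := u) = vec3 x u z" "(vec3 x y z)(3 := u) = vec3 x y u"
proof -
  have neq: "(2::3) \<noteq> 1" "(3::3) \<noteq> 1" "(3::3) \<noteq> 2" by simp_all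
  show "vec3 x y z 1 = x" "vec3 x y z 2 = y" "vec3 x y z 3 = z"
    unfolding vec3_def by (simp_all only: neq simp_thms if_True if_False)
  show "(vec3 x y z)(1 := u) = vec3 u y z" "(vec3 x y z)(2 := u) = vec3 x u z" "(vec3 x y z)(3 := u) = vec3 x y u"
    unfolding fun_eq_iff forall_3 fun_upd_apply vec3_def
    by (simp_all only: neq neq[symmetric] simp_thms if_True if_False)
qed

lemma vec3_eta: "vec3 (v 1) (v 2) (v 3) = v"
  unfolding fun_eq_iff forall_3 by simp

abbreviation Hom_ext3 :: "(('n::finite mspace, 3) ext \<Rightarrow> real) set"
  where "Hom_ext3 \<equiv> Hom_mod h_alg (ext_action ad) trivial_action"

definition ext3_form :: "(('n::finite mspace, 3) ext \<Rightarrow> real) \<Rightarrow> 'n mspace \<Rightarrow> 'n mspace \<Rightarrow> 'n mspace \<Rightarrow> real"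
  where "ext3_form F x y z = F (wedge (vec3 x y z))"

lemma linear_ext3_form: "linear ext3_form"
  by (intro linearI ext) (simp_all add: ext3_form_def)

lemma ext3_eqI:
  assumes "linear F" "linear G" "\<And>x y z. F (wedge (vec3 x y z)) = G (wedge (vec3 x y z))"
  shows "F = G"
  by (rule ext_eqI[OF assms(1,2)]) (metis assms(3) vec3_eta)

lemma inj_on_ext3_form: "inj_on ext3_form Hom_ext3"
proof (rule inj_onI)
  fix F G :: "('a mspace, 3) ext \<Rightarrow> real"
  assume "F \<in> Hom_ext3" "G \<in> Hom_ext3" and eq: "ext3_form F = ext3_form G"
  then have "linear F" "linear G" by (simp_all add: Hom_mod_def)
  then show "F = G" by (rule ext3_eqI) (use eq in \<open>simp add: ext3_form_def fun_eq_iff\<close>)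
qed

lemma Hom_mod_ext3_iff:
  assumes "linear F"
  shows "F \<in> Hom_ext3 \<longleftrightarrow> (\<forall>X\<in>h_alg. \<forall>x y z.
    F (wedge (vec3 (ad X x) y z)) + F (wedge (vec3 x (ad X y) z)) + F (wedge (vec3 x y (ad X z))) = 0)"
proof -
  have "(\<forall>w. F (ext_action ad X w) = 0) \<longleftrightarrow> (\<forall>x y z. F (wedge (vec3 (ad X x) y z))
      + F (wedge (vec3 x (ad X y) z)) + F (wedge (vec3 x y (ad X z))) = 0)"
    if X: "X \<in> h_alg" for X
  proof -
    note act = linear_ext_action[of ad X, OF linear_ad[OF X]] ext_action_wedge[of ad X, OF linear_ad[OF X]]
    have *: "F (wedge (vec3 (ad X x) y z)) + F (wedge (vec3 x (ad X y) z)) + F (wedge (vec3 x y (ad X z)))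
        = F (ext_action ad X (wedge (vec3 x y z)))" for x y z
      by (simp add: act sum_3 linear_add[OF assms])
    show ?thesis
      using ext3_eqI[OF linear_compose[OF act(1) assms] linear_zero]
      unfolding * o_def by metis
  qed
  then show ?thesis using assms by (simp add: Hom_mod_def trivial_action_def)
qed

text \<open>
  Composition with \<open>wedge\<close> is the universal property of the exterior power. Skewness under the two
  transpositions of neighbours suffices for the form to be alternating.
\<close>

lemma ext3_form_image:
  "ext3_form ` Hom_ext3 = {\<tau>. invariant_form \<tau> \<and>
    (\<forall>x y z. \<tau> x z y = - \<tau> x y z) \<and> (\<forall>x y z. \<tau> y x z = - \<tau> x y z)}"
proof (intro equalityI subsetI)
  fix \<tau> :: "'a mspace \<Rightarrow> 'a mspace \<Rightarrow> 'a mspace \<Rightarrow> real"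
  assume "\<tau> \<in> ext3_form ` Hom_ext3"
  then obtain F where F: "F \<in> Hom_ext3" and \<tau>: "\<tau> = ext3_form F" by blast
  have lin: "linear F" using F by (simp add: Hom_mod_def)
  have "linear (\<lambda>x. wedge (vec3 x y z))" "linear (\<lambda>x. wedge (vec3 y x z))" "linear (\<lambda>x. wedge (vec3 y z x))"
    for y z :: "'a mspace"
    using linear_wedge[of "vec3 y y z" 1] linear_wedge[of "vec3 y y z" 2] linear_wedge[of "vec3 y z z" 3]
    by simp_all
  then have "trilinear \<tau>"
    unfolding \<tau> trilinear_def ext3_form_def using linear_compose[OF _ lin] unfolding o_def by blast
  moreover have "\<tau> (ad X x) y z + \<tau> x (ad X y) z + \<tau> x y (ad X z) = 0" if X: "X \<in> h_alg" for X x y z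
    using F X by (simp add: Hom_mod_ext3_iff[OF lin] \<tau> ext3_form_def)
  moreover have "\<tau> x z y = - \<tau> x y z" for x y z
    using wedge_swap[of 2 3 "vec3 x y z" z y]
    by (simp add: \<tau> ext3_form_def eq_neg_iff_add_eq_0 flip: linear_add[OF lin]) (simp add: linear_0[OF lin])
  moreover have "\<tau> y x z = - \<tau> x y z" for x y z
    using wedge_swap[of 1 2 "vec3 x y z" y x]
    by (simp add: \<tau> ext3_form_def eq_neg_iff_add_eq_0 flip: linear_add[OF lin]) (simp add: linear_0[OF lin])
  ultimately show "\<tau> \<in> {\<tau>. invariant_form \<tau> \<and>
      (\<forall>x y z. \<tau> x z y = - \<tau> x y z) \<and> (\<forall>x y z. \<tau> y x z = - \<tau> x y z)}"
    unfolding invariant_form_def by blast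
next
  fix \<tau> :: "'a mspace \<Rightarrow> 'a mspace \<Rightarrow> 'a mspace \<Rightarrow> real"
  assume "\<tau> \<in> {\<tau>. invariant_form \<tau> \<and>
      (\<forall>x y z. \<tau> x z y = - \<tau> x y z) \<and> (\<forall>x y z. \<tau> y x z = - \<tau> x y z)}"
  then have tri: "trilinear \<tau>" and skew: "\<And>x y z. \<tau> x z y = - \<tau> x y z" "\<And>x y z. \<tau> y x z = - \<tau> x y z"
    and inv: "\<And>X x y z. X \<in> h_alg \<Longrightarrow> \<tau> (ad X x) y z + \<tau> x (ad X y) z + \<tau> x y (ad X z) = 0"
    unfolding invariant_form_def by blast+
  let ?g = "\<lambda>v :: 3 \<Rightarrow> 'a mspace. \<tau> (v 1) (v 2) (v 3)"
  have m: "multilinear ?g"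
    unfolding multilinear_def
  proof (intro allI)
    fix v :: "3 \<Rightarrow> 'a mspace" and i :: 3
    obtain a b c where v: "v = vec3 a b c" using vec3_eta[of v, symmetric] by blast
    show "linear (\<lambda>x. ?g (v(i := x)))"
      unfolding v using exhaust_3[of i] trilinearD[OF tri]
      by (elim disjE) simp_all
  qed
  have a: "alternating ?g"
    unfolding alternating_def
  proof (intro allI impI)
    fix v :: "3 \<Rightarrow> 'a mspace" and i j :: 3
    assume "i \<noteq> j" "v i = v j"
    then have "v 1 = v 2 \<or> v 2 = v 3 \<or> v 1 = v 3"
      using exhaust_3[of i] exhaust_3[of j] by auto
    moreover have "\<tau> x x y = 0" "\<tau> y x x = 0" "\<tau> x y x = 0" for x y
      using skew(2)[of x x y] skew(1)[of y x x] skew(1)[of x y x] by simp_all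
    ultimately show "?g v = 0" by auto
  qed
  note F = linear_ext_lift[OF m a] ext_lift_wedge[OF m a]
  have hom: "ext_lift ?g \<in> Hom_ext3"
    unfolding Hom_mod_ext3_iff[OF F(1)] F(2) using inv by simp
  have "\<tau> = ext3_form (ext_lift ?g)"
    by (intro ext) (simp add: ext3_form_def F(2))
  then show "\<tau> \<in> ext3_form ` Hom_ext3" using hom by (rule image_eqI)
qed

lemma linear_trivial_action: "linear (trivial_action X)"
  by (intro linearI) (simp_all add: trivial_action_def)

lemma dim_Hom_ext3:
  assumes n: "CARD('n::finite) \<ge> 3"
  shows "dim (Hom_ext3 :: (('n mspace, 3) ext \<Rightarrow> real) set) = 10"
proof -
  have "{\<tau> :: 'n mspace \<Rightarrow> _. invariant_form \<tau> \<and>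
      (\<forall>x y z. \<tau> x z y = - \<tau> x y z) \<and> (\<forall>x y z. \<tau> y x z = - \<tau> x y z)}
      = form_of ` {P. swap23 P = - P \<and> swap12 P = - P}"
    by (rule invariant_forms_eq_image[OF n]) (simp only: form_of_skew23_iff form_of_skew12_iff)
  also have "\<dots> = range (form_of \<circ> alternating_params)"
    by (simp only: image_comp[symmetric] range_alternating_params)
  finally have "ext3_form ` (Hom_ext3 :: (('n mspace, 3) ext \<Rightarrow> real) set) = range (form_of \<circ> alternating_params)"
    by (simp only: ext3_form_image)
  from dim_eq_DIM_if_same_image[OF linear_ext3_form inj_on_ext3_form
      subspace_Hom_mod[OF linear_trivial_action]
      linear_compose[OF linear_alternating_params linear_form_of]
      inj_compose[OF inj_form_of inj_alternating_params] this]
  show ?thesis by simp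
qed

section \<open>The dimensions\<close>

theorem lemma4p11:
  fixes k :: nat
  assumes "k \<ge> 7" and "CARD('n::finite) = k - 4"
  shows "dim (Hom_mod (h_alg :: (real^('n + 4)^('n + 4)) set)
        (tensor_action ad ad :: _ \<Rightarrow> ('n mspace, 'n mspace) tensor \<Rightarrow> _)
        (ad :: _ \<Rightarrow> 'n mspace \<Rightarrow> _)) = 63
    \<and> dim (Hom_mod (h_alg :: (real^('n + 4)^('n + 4)) set)
        (ad :: _ \<Rightarrow> 'n mspace \<Rightarrow> _)
        (ext_action ad :: _ \<Rightarrow> ('n mspace, 2) ext \<Rightarrow> _)) = 30
    \<and> dim (Hom_mod (h_alg :: (real^('n + 4)^('n + 4)) set)
        (ext_action ad :: _ \<Rightarrow> ('n mspace, 3) ext \<Rightarrow> _)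
        trivial_action) = 10"
proof -
  have "CARD('n) \<ge> 3" using assms by simp
  then show ?thesis
    by (intro conjI dim_Hom_tensor dim_Hom_ext2 dim_Hom_ext3)
qed

end
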